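(* The category of top-heavy locally inductive groupoids and ordered functors is equivalent to the category of inverse categories and oplax functors.
   Context: Composition is written right to left: $gf$ means first $f$, then $g$. **Inverse categories.** A category $\mathbf{X}$ is an inverse category if for each arrow $f:A\to B$ there is a unique arrow $f^\circ:B\to A$ with $ff^\circ f=f$ and $f^\circ f f^\circ=f^\circ$. Put $\overline{f}=f^\circ f:A\to A$. For parallel arrows $f,g$ put $f\le g$ iff $f=g\overline{f}$. An oplax functor $F:\mathbf{X}\to\mathbf{X}'$ of inverse categories assigns to each object $A$ of $\mathbf{X}$ an object $F(A)$ of $\mathbf{X}'$ and to each arrow $f:A\to B$ an arrow $F(f):F(A)\to F(B)$ such that $F(gf)\le F(g)F(f)$ for each composable pair $f:A\to B$, $g:B\to C$, and $F(1_A)\le 1_{F(A)}$ for each object $A$. **Ordered groupoids.** An ordered groupoid is a groupoid $\mathbf{G}$ with a partial order $\le$ on its arrows (and on objects via $A\le B$ iff $1_A\le 1_B$) such that: (i) $f\le g$ implies $f^{-1}\le g^{-1}$; (ii) if $a\le A$, $b\le B$ and the composites $ab$, $AB$ exist, then $ab\le AB$; (iii) for each arrow $f:A'\to B$ and object $A\le A'$ there is a unique arrow $[f|_*A]\le f$ with domain $A$; (iv) for each arrow $f:A\to B'$ and object $B\le B'$ there is a unique arrow $[B\,{}_*|f]\le f$ with codomain $B$. An ordered functor is a functor between ordered groupoids preserving $\le$ on arrows. An ordered groupoid is locally inductive if there is a partition $\{M_i\}_{i\in I}$ of its set of objects into meet-semilattices $M_i$ such that any two comparable objects lie in the same $M_i$.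 It is top-heavy if each $M_i$ has a top element. *)

theory Defs
  imports Main "HOL-Library.FuncSet" "HOL-Library.Disjoint_Sets"
begin

section \<open>Categories\<close>

record ('o, 'a) cat =
  Obj :: "'o set"
  Arr :: "'a set"
  Dom :: "'a \<Rightarrow> 'o"
  Cod :: "'a \<Rightarrow> 'o"
  Ident :: "'o \<Rightarrow> 'a"
  Comp :: "'a \<Rightarrow> 'a \<Rightarrow> 'a"  (infixl "\<cdot>\<index>" 70)

definition hom :: "('o, 'a, 'm) cat_scheme \<Rightarrow> 'o \<Rightarrow> 'o \<Rightarrow> 'a set" where
  "hom C A B = {f \<in> Arr C. Dom C f = A \<and> Cod C f = B}"

text \<open>Composition is written right to left: \<open>g \<cdot> f\<close> is first \<open>f\<close>, then \<open>g\<close>.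
  The last four axioms only fix the junk values of the operations outside their
  domains of definition, so that a category is represented by exactly one record.\<close>

locale category =
  fixes C :: "('o, 'a, 'm) cat_scheme" (structure)
  assumes Dom_in: "f \<in> Arr C \<Longrightarrow> Dom C f \<in> Obj C"
    and Cod_in: "f \<in> Arr C \<Longrightarrow> Cod C f \<in> Obj C"
    and Ident_in: "A \<in> Obj C \<Longrightarrow> Ident C A \<in> hom C A A"
    and Comp_in: "\<lbrakk>f \<in> hom C X Y; g \<in> hom C Y Z\<rbrakk> \<Longrightarrow> g \<cdot> f \<in> hom C X Z"
    and Comp_Ident: "f \<in> hom C X Y \<Longrightarrow> f \<cdot> Ident C X = f"
    and Ident_Comp: "f \<in> hom C X Y \<Longrightarrow> Ident C Y \<cdot> f = f"
    and Comp_assoc: "\<lbrakk>f \<in> hom C W X; g \<in> hom C X Y; h \<in> hom C Y Z\<rbrakk>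
          \<Longrightarrow> (h \<cdot> g) \<cdot> f = h \<cdot> (g \<cdot> f)"
    and Dom_ext: "Dom C \<in> extensional (Arr C)"
    and Cod_ext: "Cod C \<in> extensional (Arr C)"
    and Ident_ext: "Ident C \<in> extensional (Obj C)"
    and Comp_ext: "\<not> (f \<in> Arr C \<and> g \<in> Arr C \<and> Cod C f = Dom C g) \<Longrightarrow> g \<cdot> f = undefined"

definition iso_arr :: "('o, 'a, 'm) cat_scheme \<Rightarrow> 'a \<Rightarrow> bool" where
  "iso_arr C f \<longleftrightarrow> f \<in> Arr C \<and>
     (\<exists>g \<in> hom C (Cod C f) (Dom C f).
        g \<cdot>\<^bsub>C\<^esub> f = Ident C (Dom C f) \<and> f \<cdot>\<^bsub>C\<^esub> g = Ident C (Cod C f))"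


section \<open>Functors and equivalence of categories\<close>

record ('o, 'a, 'p, 'b) cat_map =
  OMap :: "'o \<Rightarrow> 'p"
  AMap :: "'a \<Rightarrow> 'b"

text \<open>The data common to functors and oplax functors. The function spaces \<open>\<rightarrow>\<^sub>E\<close> are
  extensional, so two such maps are equal iff they agree on the objects and arrows of \<open>C\<close>.\<close>

definition graph_map ::
  "('o, 'a, 'm) cat_scheme \<Rightarrow> ('p, 'b, 'n) cat_scheme \<Rightarrow> ('o, 'a, 'p, 'b) cat_map \<Rightarrow> bool" where
  "graph_map C D F \<longleftrightarrow>
     OMap F \<in> Obj C \<rightarrow>\<^sub>E Obj D \<and> AMap F \<in> Arr C \<rightarrow>\<^sub>E Arr D \<and>
     (\<forall>f \<in> Arr C. AMap F f \<in> hom D (OMap F (Dom C f)) (OMap F (Cod C f)))"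

definition is_functor ::
  "('o, 'a, 'm) cat_scheme \<Rightarrow> ('p, 'b, 'n) cat_scheme \<Rightarrow> ('o, 'a, 'p, 'b) cat_map \<Rightarrow> bool" where
  "is_functor C D F \<longleftrightarrow> graph_map C D F \<and>
     (\<forall>A \<in> Obj C. AMap F (Ident C A) = Ident D (OMap F A)) \<and>
     (\<forall>f \<in> Arr C. \<forall>g \<in> Arr C. Cod C f = Dom C g \<longrightarrow>
        AMap F (g \<cdot>\<^bsub>C\<^esub> f) = AMap F g \<cdot>\<^bsub>D\<^esub> AMap F f)"

definition map_id :: "('o, 'a, 'm) cat_scheme \<Rightarrow> ('o, 'a, 'o, 'a) cat_map" where
  "map_id C = \<lparr>OMap = (\<lambda>A \<in> Obj C. A), AMap = (\<lambda>f \<in> Arr C. f)\<rparr>"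

definition map_comp ::
  "('o, 'a, 'm) cat_scheme \<Rightarrow> ('p, 'b, 'q, 'c) cat_map \<Rightarrow> ('o, 'a, 'p, 'b) cat_map
     \<Rightarrow> ('o, 'a, 'q, 'c) cat_map" where
  "map_comp C G F =
     \<lparr>OMap = compose (Obj C) (OMap G) (OMap F), AMap = compose (Arr C) (AMap G) (AMap F)\<rparr>"

definition natural_iso ::
  "('o, 'a, 'm) cat_scheme \<Rightarrow> ('p, 'b, 'n) cat_scheme
     \<Rightarrow> ('o, 'a, 'p, 'b) cat_map \<Rightarrow> ('o, 'a, 'p, 'b) cat_map \<Rightarrow> ('o \<Rightarrow> 'b) \<Rightarrow> bool" where
  "natural_iso C D F G \<eta> \<longleftrightarrow> is_functor C D F \<and> is_functor C D G \<and>
     (\<forall>A \<in> Obj C. \<eta> A \<in> hom D (OMap F A) (OMap G A) \<and> iso_arr D (\<eta> A)) \<and>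
     (\<forall>f \<in> Arr C. \<eta> (Cod C f) \<cdot>\<^bsub>D\<^esub> AMap F f = AMap G f \<cdot>\<^bsub>D\<^esub> \<eta> (Dom C f))"

definition equivalent_categories ::
  "('o, 'a, 'm) cat_scheme \<Rightarrow> ('p, 'b, 'n) cat_scheme \<Rightarrow> bool" where
  "equivalent_categories C D \<longleftrightarrow> category C \<and> category D \<and>
     (\<exists>F G \<eta> \<epsilon>. is_functor C D F \<and> is_functor D C G \<and>
        natural_iso C C (map_id C) (map_comp C G F) \<eta> \<and>
        natural_iso D D (map_comp D F G) (map_id D) \<epsilon>)"

text \<open>The category whose objects are the structures in \<open>S\<close> and whose arrows \<open>K \<rightarrow> L\<close> are the
  maps \<open>F\<close> with \<open>P K L F\<close>, tagged with \<open>K\<close> and \<open>L\<close>.\<close>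

definition category_of ::
  "('o, 'a, 'm) cat_scheme set
     \<Rightarrow> (('o, 'a, 'm) cat_scheme \<Rightarrow> ('o, 'a, 'm) cat_scheme \<Rightarrow> ('o, 'a, 'o, 'a) cat_map \<Rightarrow> bool)
     \<Rightarrow> (('o, 'a, 'm) cat_scheme,
         ('o, 'a, 'm) cat_scheme \<times> ('o, 'a, 'o, 'a) cat_map \<times> ('o, 'a, 'm) cat_scheme) cat" where
  "category_of S P =
     (let As = {(K, F, L). K \<in> S \<and> L \<in> S \<and> P K L F} in
       \<lparr>Obj = S,
        Arr = As,
        Dom = (\<lambda>(K, F, L) \<in> As. K),
        Cod = (\<lambda>(K, F, L) \<in> As. L),
        Ident = (\<lambda>K \<in> S. (K, map_id K, K)),
        Comp = (\<lambda>(L', G, M) (K, F, L).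
          if (K, F, L) \<in> As \<and> (L', G, M) \<in> As \<and> L = L'
          then (K, map_comp K G F, M) else undefined)\<rparr>)"


section \<open>Inverse categories and oplax functors\<close>

definition is_inverse_of :: "('o, 'a, 'm) cat_scheme \<Rightarrow> 'a \<Rightarrow> 'a \<Rightarrow> bool" where
  "is_inverse_of X f g \<longleftrightarrow> g \<in> hom X (Cod X f) (Dom X f) \<and>
     f \<cdot>\<^bsub>X\<^esub> g \<cdot>\<^bsub>X\<^esub> f = f \<and> g \<cdot>\<^bsub>X\<^esub> f \<cdot>\<^bsub>X\<^esub> g = g"

locale inverse_category = category X for X :: "('o, 'a, 'm) cat_scheme" (structure) +
  assumes unique_inverse: "f \<in> Arr X \<Longrightarrow> \<exists>!g. is_inverse_of X f g"

definition inv_arr :: "('o, 'a, 'm) cat_scheme \<Rightarrow> 'a \<Rightarrow> 'a" where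
  "inv_arr X f = (THE g. is_inverse_of X f g)"

definition bar :: "('o, 'a, 'm) cat_scheme \<Rightarrow> 'a \<Rightarrow> 'a" where
  "bar X f = inv_arr X f \<cdot>\<^bsub>X\<^esub> f"

definition nat_le :: "('o, 'a, 'm) cat_scheme \<Rightarrow> 'a \<Rightarrow> 'a \<Rightarrow> bool" where
  "nat_le X f g \<longleftrightarrow> f \<in> Arr X \<and> g \<in> Arr X \<and> Dom X f = Dom X g \<and> Cod X f = Cod X g \<and>
     f = g \<cdot>\<^bsub>X\<^esub> bar X f"

definition oplax_functor ::
  "('o, 'a, 'm) cat_scheme \<Rightarrow> ('p, 'b, 'n) cat_scheme \<Rightarrow> ('o, 'a, 'p, 'b) cat_map \<Rightarrow> bool" where
  "oplax_functor X Y F \<longleftrightarrow> graph_map X Y F \<and>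
     (\<forall>f \<in> Arr X. \<forall>g \<in> Arr X. Cod X f = Dom X g \<longrightarrow>
        nat_le Y (AMap F (g \<cdot>\<^bsub>X\<^esub> f)) (AMap F g \<cdot>\<^bsub>Y\<^esub> AMap F f)) \<and>
     (\<forall>A \<in> Obj X. nat_le Y (AMap F (Ident X A)) (Ident Y (OMap F A)))"


section \<open>Ordered groupoids and ordered functors\<close>

locale groupoid = category G for G :: "('o, 'a, 'm) cat_scheme" (structure) +
  assumes all_iso: "f \<in> Arr G \<Longrightarrow> iso_arr G f"

definition ginv :: "('o, 'a, 'm) cat_scheme \<Rightarrow> 'a \<Rightarrow> 'a" where
  "ginv G f = (THE g. g \<in> hom G (Cod G f) (Dom G f) \<and>
     g \<cdot>\<^bsub>G\<^esub> f = Ident G (Dom G f) \<and> f \<cdot>\<^bsub>G\<^esub> g = Ident G (Cod G f))"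

record ('o, 'a) ocat = "('o, 'a) cat" +
  Le :: "('a \<times> 'a) set"

definition obj_le :: "('o, 'a, 'm) ocat_scheme \<Rightarrow> 'o \<Rightarrow> 'o \<Rightarrow> bool" where
  "obj_le G A B \<longleftrightarrow> A \<in> Obj G \<and> B \<in> Obj G \<and> (Ident G A, Ident G B) \<in> Le G"

locale ordered_groupoid = groupoid G for G :: "('o, 'a, 'm) ocat_scheme" (structure) +
  assumes Le_order: "partial_order_on (Arr G) (Le G)"
    and Le_inv: "(f, g) \<in> Le G \<Longrightarrow> (ginv G f, ginv G g) \<in> Le G"
    and Le_Comp: "\<lbrakk>(a, a') \<in> Le G; (b, b') \<in> Le G; Cod G b = Dom G a; Cod G b' = Dom G a'\<rbrakk>
          \<Longrightarrow> (a \<cdot> b, a' \<cdot> b') \<in> Le G"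
    and restriction: "\<lbrakk>f \<in> Arr G; obj_le G A (Dom G f)\<rbrakk>
          \<Longrightarrow> \<exists>!h. (h, f) \<in> Le G \<and> Dom G h = A"
    and corestriction: "\<lbrakk>f \<in> Arr G; obj_le G B (Cod G f)\<rbrakk>
          \<Longrightarrow> \<exists>!h. (h, f) \<in> Le G \<and> Cod G h = B"

definition ordered_functor ::
  "('o, 'a, 'm) ocat_scheme \<Rightarrow> ('p, 'b, 'n) ocat_scheme \<Rightarrow> ('o, 'a, 'p, 'b) cat_map \<Rightarrow> bool" where
  "ordered_functor G H F \<longleftrightarrow> is_functor G H F \<and>
     (\<forall>(f, g) \<in> Le G. (AMap F f, AMap F g) \<in> Le H)"

definition meet_semilattice_on :: "'o set \<Rightarrow> ('o \<Rightarrow> 'o \<Rightarrow> bool) \<Rightarrow> bool" where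
  "meet_semilattice_on M le \<longleftrightarrow>
     partial_order_on M {(A, B). A \<in> M \<and> B \<in> M \<and> le A B} \<and>
     (\<forall>A \<in> M. \<forall>B \<in> M. \<exists>C \<in> M. le C A \<and> le C B \<and> (\<forall>D \<in> M. le D A \<and> le D B \<longrightarrow> le D C))"

definition semilattice_partition :: "('o, 'a, 'm) ocat_scheme \<Rightarrow> 'o set set \<Rightarrow> bool" where
  "semilattice_partition G P \<longleftrightarrow> partition_on (Obj G) P \<and>
     (\<forall>M \<in> P. meet_semilattice_on M (obj_le G)) \<and>
     (\<forall>A B. obj_le G A B \<longrightarrow> (\<exists>M \<in> P. A \<in> M \<and> B \<in> M))"

definition locally_inductive :: "('o, 'a, 'm) ocat_scheme \<Rightarrow> bool" where
  "locally_inductive G \<longleftrightarrow> ordered_groupoid G \<and> (\<exists>P. semilattice_partition G P)"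

text \<open>Such a partition is unique (its blocks are the connected components of the order on
  objects), so quantifying over it again is harmless.\<close>

definition top_heavy :: "('o, 'a, 'm) ocat_scheme \<Rightarrow> bool" where
  "top_heavy G \<longleftrightarrow>
     (\<exists>P. semilattice_partition G P \<and> (\<forall>M \<in> P. \<exists>T \<in> M. \<forall>A \<in> M. obj_le G A T))"


section \<open>The two categories\<close>

text \<open>Smallness is relative to an arbitrary type \<open>'u\<close>: the objects and the arrows of the
  structures are taken from \<open>'u\<close>. Objects and arrows share the type because the objects of the
  groupoid attached to an inverse category are idempotent arrows of the latter; this costs no
  generality, as objects in \<open>'o\<close> and arrows in \<open>'a\<close> can both be taken from \<open>'o + 'a\<close>.\<close>

type_synonym 'u inv_cats =
  "(('u, 'u) cat, ('u, 'u) cat \<times> ('u, 'u, 'u, 'u) cat_map \<times> ('u, 'u) cat) cat"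

type_synonym 'u th_groupoids =
  "(('u, 'u) ocat, ('u, 'u) ocat \<times> ('u, 'u, 'u, 'u) cat_map \<times> ('u, 'u) ocat) cat"

definition Inverse_Categories :: "'u inv_cats" where
  "Inverse_Categories = category_of {X. inverse_category X} oplax_functor"

definition Top_Heavy_Groupoids :: "'u th_groupoids" where
  "Top_Heavy_Groupoids = category_of {G. locally_inductive G \<and> top_heavy G} ordered_functor"

end

theory Submission
  imports Defs
begin

text \<open>An inverse category and the groupoid attached to it have the same arrows; only objects and
composition change. From an inverse category \<open>X\<close> one passes to the groupoid whose objects are the
idempotents of \<open>X\<close>, in which \<open>f\<close> runs from \<open>f\<^sup>\<circ> f\<close> to \<open>f f\<^sup>\<circ>\<close> and only those composites \<open>g f\<close> are kept
for which \<open>f f\<^sup>\<circ> = g\<^sup>\<circ> g\<close>; its order is the natural order of \<open>X\<close> (\<open>groupoid_of\<close>). The idempotents on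
one object \<open>A\<close> of \<open>X\<close> form a semilattice with top \<open>1\<^sub>A\<close>, since idempotents commute.

In the other direction, a top-heavy locally inductive groupoid \<open>G\<close> becomes a category whose objects
are the tops of its semilattices, that is, its maximal objects. If the codomain of \<open>f\<close> and the domain
of \<open>g\<close> lie under the same top, then among the composites \<open>g' f'\<close> in \<open>G\<close> with \<open>g' \<le> g\<close> and \<open>f' \<le> f\<close>
there is a greatest one, obtained by restricting both arrows to the meet of the two objects. It is
the composite of \<open>f\<close> and \<open>g\<close> in the new category (\<open>pseudo_product\<close>, \<open>inverse_category_of\<close>). Since it
is defined by maximality, associativity reduces to the fact that both bracketings of \<open>h\<close>, \<open>g\<close>, \<open>f\<close>
give the greatest composite \<open>h' g' f'\<close>. The inverse of \<open>f\<close> in the groupoid is its unique inverse for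
the new composition, and the natural order of the new category is the given order
(\<open>inverse_category_inverse_category_of\<close>, \<open>nat_le_inverse_category_of\<close>). Going back and forth changes
nothing on arrows and only renames objects, \<open>A\<close> being replaced by \<open>1\<^sub>A\<close>.

Maps behave in the same way. An ordered functor preserves composites and order, so it sends a greatest
composite to one of the composites whose greatest member is the pseudo-product of the images; this
is oplaxness (\<open>map_pseudo_product_le\<close>). Conversely an oplax functor \<open>F\<close> is strict where it matters:
if \<open>e\<close> is idempotent and \<open>x = F(e)\<close>, then \<open>x \<le> x x\<close>, which says \<open>x = x x (x\<^sup>\<circ> x) = x x\<close>. So \<open>F\<close>
preserves idempotents, and for similar reasons inverses, bars and the composites kept in the groupoid
(\<open>preserves_idempotent\<close>, \<open>preserves_inv\<close>, \<open>preserves_bar\<close>, \<open>preserves_groupoid_comp\<close>).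

On both sides a map is determined by its values on arrows, because the image of an object can be read
off from the image of its identity. Hence functoriality of the two constructions, and naturality of
the comparison maps, need to be checked only on arrows, where every map involved is the original one
or the identity. This formal part is
\<open>equivalence_by_arrow_preserving_constructions\<close>.\<close>

section \<open>Composition in terms of arrows, domains and codomains\<close>

context category
begin

lemma Ident_simps [simp]:
  assumes "A \<in> Obj C"
  shows "Ident C A \<in> Arr C" "Dom C (Ident C A) = A" "Cod C (Ident C A) = A"
  using Ident_in [OF assms] by (auto simp: hom_def)

lemma Comp_simps [simp]:
  assumes "f \<in> Arr C" "g \<in> Arr C" "Cod C f = Dom C g"
  shows "g \<cdot> f \<in> Arr C" "Dom C (g \<cdot> f) = Dom C f" "Cod C (g \<cdot> f) = Cod C g"
  using Comp_in [of f "Dom C f" "Cod C f" g "Cod C g"] assms by (auto simp: hom_def)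

lemma Comp_Ident_Dom [simp]: "f \<in> Arr C \<Longrightarrow> A = Dom C f \<Longrightarrow> f \<cdot> Ident C A = f"
  by (rule Comp_Ident) (simp add: hom_def)

lemma Ident_Cod_Comp [simp]: "f \<in> Arr C \<Longrightarrow> A = Cod C f \<Longrightarrow> Ident C A \<cdot> f = f"
  by (rule Ident_Comp) (simp add: hom_def)

lemma assoc:
  "\<lbrakk>f \<in> Arr C; g \<in> Arr C; h \<in> Arr C; Cod C f = Dom C g; Cod C g = Dom C h\<rbrakk>
     \<Longrightarrow> h \<cdot> g \<cdot> f = h \<cdot> (g \<cdot> f)"
  by (rule Comp_assoc) (auto simp: hom_def)

lemma Ident_inject: "\<lbrakk>A \<in> Obj C; B \<in> Obj C; Ident C A = Ident C B\<rbrakk> \<Longrightarrow> A = B"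
  by (metis Ident_simps(2))

end

lemma graph_mapD:
  assumes "graph_map C D F"
  shows "A \<in> Obj C \<Longrightarrow> OMap F A \<in> Obj D"
    and "f \<in> Arr C \<Longrightarrow> AMap F f \<in> Arr D"
    and "f \<in> Arr C \<Longrightarrow> Dom D (AMap F f) = OMap F (Dom C f)"
    and "f \<in> Arr C \<Longrightarrow> Cod D (AMap F f) = OMap F (Cod C f)"
  using assms by (auto simp: graph_map_def hom_def)

lemma graph_map_eqI:
  assumes "graph_map C D F" "graph_map C D G"
    and "\<And>A. A \<in> Obj C \<Longrightarrow> OMap F A = OMap G A"
    and "\<And>f. f \<in> Arr C \<Longrightarrow> AMap F f = AMap G f"
  shows "F = G"
proof -
  have "OMap F = OMap G"
    using assms by (intro extensionalityI [of _ "Obj C"]) (auto simp: graph_map_def PiE_def)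
  moreover have "AMap F = AMap G"
    using assms by (intro extensionalityI [of _ "Arr C"]) (auto simp: graph_map_def PiE_def)
  ultimately show ?thesis
    by (cases F; cases G) simp
qed

lemma map_id_simps [simp]:
  "A \<in> Obj C \<Longrightarrow> OMap (map_id C) A = A" "f \<in> Arr C \<Longrightarrow> AMap (map_id C) f = f"
  by (simp_all add: map_id_def)

lemma map_comp_simps [simp]:
  "A \<in> Obj C \<Longrightarrow> OMap (map_comp C G F) A = OMap G (OMap F A)"
  "f \<in> Arr C \<Longrightarrow> AMap (map_comp C G F) f = AMap G (AMap F f)"
  by (simp_all add: map_comp_def compose_def)

lemma graph_map_id: "category C \<Longrightarrow> graph_map C C (map_id C)"
  unfolding graph_map_def
  by (auto simp: category.Dom_in category.Cod_in hom_def) (auto simp: map_id_def)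

lemma graph_map_comp:
  assumes "graph_map C D F" "graph_map D E G" "category C"
  shows "graph_map C E (map_comp C G F)"
  using assms(1,2) category.Dom_in [OF assms(3)] category.Cod_in [OF assms(3)]
  by (auto simp: graph_map_def hom_def PiE_iff) (auto simp: map_comp_def compose_def)

lemma functor_id: "category C \<Longrightarrow> is_functor C C (map_id C)"
  by (auto simp: is_functor_def graph_map_id category.Ident_simps category.Comp_simps)

lemma functor_comp:
  assumes "is_functor C D F" "is_functor D E G" "category C"
  shows "is_functor C E (map_comp C G F)"
  using assms graph_mapD [of C D F]
  by (auto simp: is_functor_def graph_map_comp category.Ident_simps category.Comp_simps)

section \<open>Categories of structures whose maps are determined on arrows\<close>

text \<open>The last axiom is what makes the equivalence formal: two maps that agree on arrows are equal, so no
equation between maps ever has to be checked on objects.\<close>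

locale arrow_determined =
  fixes S :: "('o, 'a, 'm) cat_scheme set"
    and P :: "('o, 'a, 'm) cat_scheme \<Rightarrow> ('o, 'a, 'm) cat_scheme \<Rightarrow> ('o, 'a, 'o, 'a) cat_map \<Rightarrow> bool"
  assumes graph: "\<lbrakk>K \<in> S; L \<in> S; P K L F\<rbrakk> \<Longrightarrow> graph_map K L F"
    and id_closed: "K \<in> S \<Longrightarrow> P K K (map_id K)"
    and comp_closed: "\<lbrakk>K \<in> S; L \<in> S; M \<in> S; P K L F; P L M G\<rbrakk> \<Longrightarrow> P K M (map_comp K G F)"
    and object_map_determined:
      "\<lbrakk>K \<in> S; L \<in> S; P K L F; P K L G; \<And>f. f \<in> Arr K \<Longrightarrow> AMap F f = AMap G f; A \<in> Obj K\<rbrakk>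
         \<Longrightarrow> OMap F A = OMap G A"
begin

lemma determined:
  "\<lbrakk>K \<in> S; L \<in> S; P K L F; P K L G; \<And>f. f \<in> Arr K \<Longrightarrow> AMap F f = AMap G f\<rbrakk> \<Longrightarrow> F = G"
  by (rule graph_map_eqI [OF graph graph]) (auto intro: object_map_determined)

lemma category_of_simps [simp]:
  "Obj (category_of S P) = S"
  "(K, F, L) \<in> Arr (category_of S P) \<longleftrightarrow> K \<in> S \<and> L \<in> S \<and> P K L F"
  "\<lbrakk>K \<in> S; L \<in> S; P K L F\<rbrakk> \<Longrightarrow> Dom (category_of S P) (K, F, L) = K"
  "\<lbrakk>K \<in> S; L \<in> S; P K L F\<rbrakk> \<Longrightarrow> Cod (category_of S P) (K, F, L) = L"
  "K \<in> S \<Longrightarrow> Ident (category_of S P) K = (K, map_id K, K)"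
  "\<lbrakk>K \<in> S; L \<in> S; M \<in> S; P K L F; P L M G\<rbrakk>
     \<Longrightarrow> Comp (category_of S P) (L, G, M) (K, F, L) = (K, map_comp K G F, M)"
  by (auto simp: category_of_def Let_def)

lemma Arr_cases:
  assumes "x \<in> Arr (category_of S P)"
  obtains K F L where "x = (K, F, L)" "K \<in> S" "L \<in> S" "P K L F"
  using assms by (auto simp: category_of_def Let_def)

lemma hom_iff: "x \<in> hom (category_of S P) K L \<longleftrightarrow> (\<exists>F. x = (K, F, L) \<and> K \<in> S \<and> L \<in> S \<and> P K L F)"
  by (auto simp: hom_def elim!: Arr_cases)

lemma category_category_of: "category (category_of S P)"
proof
  fix f g h K L M N
  show "f \<in> Arr (category_of S P) \<Longrightarrow> Dom (category_of S P) f \<in> Obj (category_of S P)"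
    by (auto elim!: Arr_cases)
  show "f \<in> Arr (category_of S P) \<Longrightarrow> Cod (category_of S P) f \<in> Obj (category_of S P)"
    by (auto elim!: Arr_cases)
  show "K \<in> Obj (category_of S P)
      \<Longrightarrow> Ident (category_of S P) K \<in> hom (category_of S P) K K"
    by (auto simp: hom_iff id_closed)
  show "\<lbrakk>f \<in> hom (category_of S P) K L; g \<in> hom (category_of S P) L M\<rbrakk>
      \<Longrightarrow> Comp (category_of S P) g f \<in> hom (category_of S P) K M"
    by (auto simp: hom_iff comp_closed)
  show "f \<in> hom (category_of S P) K L \<Longrightarrow> Comp (category_of S P) f (Ident (category_of S P) K) = f"
    by (auto simp: hom_iff id_closed intro!: determined [of K L] comp_closed [of K K L] id_closed)
  show "f \<in> hom (category_of S P) K L \<Longrightarrow> Comp (category_of S P) (Ident (category_of S P) L) f = f"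
    using graph_mapD(2) [OF graph]
    by (auto simp: hom_iff id_closed intro!: determined [of K L] comp_closed [of K L L] id_closed)
  show "\<lbrakk>f \<in> hom (category_of S P) K L; g \<in> hom (category_of S P) L M;
         h \<in> hom (category_of S P) M N\<rbrakk>
      \<Longrightarrow> Comp (category_of S P) (Comp (category_of S P) h g) f
          = Comp (category_of S P) h (Comp (category_of S P) g f)"
    using graph_mapD(2) [OF graph]
    by (auto simp: hom_iff comp_closed intro!: determined [of K N] intro: comp_closed)
  show "\<not> (f \<in> Arr (category_of S P) \<and> g \<in> Arr (category_of S P)
          \<and> Cod (category_of S P) f = Dom (category_of S P) g)
      \<Longrightarrow> Comp (category_of S P) g f = undefined"
    by (cases f; cases g) (auto simp: category_of_def Let_def)
qed (auto simp: category_of_def Let_def)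

text \<open>A map that is the identity on arrows is invertible as soon as the identity on arrows is also a map
in the other direction. It need not be an identity, since it may rename objects.\<close>

lemma iso_arr_identity_on_arrows:
  assumes "K \<in> S" "L \<in> S" "P K L F" "P L K G" "Arr K = Arr L"
    and "\<And>f. f \<in> Arr K \<Longrightarrow> AMap F f = f" "\<And>f. f \<in> Arr L \<Longrightarrow> AMap G f = f"
  shows "iso_arr (category_of S P) (K, F, L)"
proof -
  have "map_comp K G F = map_id K"
    using assms by (intro determined [of K K]) (auto intro: comp_closed [of K L] id_closed)
  moreover have "map_comp L F G = map_id L"
    using assms by (intro determined [of L L]) (auto intro: comp_closed [of L K] id_closed)
  ultimately show ?thesis
    unfolding iso_arr_def using assms by (auto simp: hom_iff intro!: bexI [of _ "(L, G, K)"])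
qed

end

text \<open>The image of a map is required only to exist: it is unique by \<open>object_map_determined\<close>, and uniqueness
turns the construction into a functor.\<close>

locale arrow_preserving_construction =
  source: arrow_determined S P + target: arrow_determined S' P'
  for S :: "('o, 'a, 'm) cat_scheme set" and P
    and S' :: "('p, 'a, 'n) cat_scheme set" and P' +
  fixes T :: "('o, 'a, 'm) cat_scheme \<Rightarrow> ('p, 'a, 'n) cat_scheme"
  assumes T_in: "K \<in> S \<Longrightarrow> T K \<in> S'"
    and T_Arr: "K \<in> S \<Longrightarrow> Arr (T K) = Arr K"
    and T_map: "\<lbrakk>K \<in> S; L \<in> S; P K L F\<rbrakk>
       \<Longrightarrow> \<exists>F'. P' (T K) (T L) F' \<and> (\<forall>f \<in> Arr K. AMap F' f = AMap F f)"
begin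

definition lifted where
  "lifted K F L = (SOME F'. P' (T K) (T L) F' \<and> (\<forall>f \<in> Arr K. AMap F' f = AMap F f))"

lemma lifted:
  assumes "K \<in> S" "L \<in> S" "P K L F"
  shows "P' (T K) (T L) (lifted K F L)" "\<And>f. f \<in> Arr K \<Longrightarrow> AMap (lifted K F L) f = AMap F f"
  using someI_ex [OF T_map [OF assms]] by (simp_all add: lifted_def)

definition induced where
  "induced = \<lparr>OMap = (\<lambda>K \<in> S. T K),
     AMap = (\<lambda>x \<in> Arr (category_of S P). case x of (K, F, L) \<Rightarrow> (T K, lifted K F L, T L))\<rparr>"

lemma induced_simps [simp]:
  "K \<in> S \<Longrightarrow> OMap induced K = T K"
  "\<lbrakk>K \<in> S; L \<in> S; P K L F\<rbrakk> \<Longrightarrow> AMap induced (K, F, L) = (T K, lifted K F L, T L)"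
  by (simp_all add: induced_def)

lemma functor_induced: "is_functor (category_of S P) (category_of S' P') induced"
  unfolding is_functor_def
proof (intro conjI ballI impI)
  show "graph_map (category_of S P) (category_of S' P') induced"
    by (auto simp: graph_map_def target.hom_iff T_in lifted elim!: source.Arr_cases)
      (auto simp: induced_def T_in lifted elim!: source.Arr_cases)
  fix K assume "K \<in> Obj (category_of S P)"
  then show "AMap induced (Ident (category_of S P) K)
      = Ident (category_of S' P') (OMap induced K)"
    by (auto simp: T_in T_Arr source.id_closed lifted
        intro!: target.determined intro: target.id_closed)
next
  fix x y
  assume "x \<in> Arr (category_of S P)" "y \<in> Arr (category_of S P)"
    and "Cod (category_of S P) x = Dom (category_of S P) y"
  then obtain K F L G M where xy: "x = (K, F, L)" "y = (L, G, M)"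
      "K \<in> S" "L \<in> S" "M \<in> S" "P K L F" "P L M G"
    by (auto elim!: source.Arr_cases)
  have "lifted K (map_comp K G F) M = map_comp (T K) (lifted L G M) (lifted K F L)"
    using xy graph_mapD(2) [OF source.graph, of K L F]
    by (intro target.determined [of "T K" "T M"])
      (auto simp: T_in T_Arr source.comp_closed [of K L M] lifted
        intro: target.comp_closed [of _ "T L"])
  then show "AMap induced (Comp (category_of S P) y x)
      = Comp (category_of S' P') (AMap induced y) (AMap induced x)"
    using xy by (simp add: T_in source.comp_closed [of K L M] lifted)
qed

end

text \<open>Every square to be checked becomes trivial on arrows: the comparison maps \<open>E\<close>, \<open>D\<close> are identities
there, and lifting a map along \<open>T\<close> and then along \<open>U\<close> changes none of its values on arrows.\<close>

theorem equivalence_by_arrow_preserving_constructions: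
  assumes "arrow_preserving_construction S P S' P' T"
    and "arrow_preserving_construction S' P' S P U"
    and unit: "\<And>K. K \<in> S \<Longrightarrow> P K (U (T K)) (E K) \<and> P (U (T K)) K (E' K)"
    and unit_id: "\<And>K f. \<lbrakk>K \<in> S; f \<in> Arr K\<rbrakk> \<Longrightarrow> AMap (E K) f = f \<and> AMap (E' K) f = f"
    and counit: "\<And>X. X \<in> S' \<Longrightarrow> P' (T (U X)) X (D X) \<and> P' X (T (U X)) (D' X)"
    and counit_id: "\<And>X f. \<lbrakk>X \<in> S'; f \<in> Arr X\<rbrakk> \<Longrightarrow> AMap (D X) f = f \<and> AMap (D' X) f = f"
  shows "equivalent_categories (category_of S P) (category_of S' P')"
proof -
  interpret T: arrow_preserving_construction S P S' P' T by fact
  interpret U: arrow_preserving_construction S' P' S P U by fact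
  let ?C = "category_of S P" and ?D = "category_of S' P'"
  have C: "category ?C" and D: "category ?D"
    by (rule T.source.category_category_of T.target.category_category_of)+
  have "natural_iso ?C ?C (map_id ?C) (map_comp ?C U.induced T.induced)
          (\<lambda>K. (K, E K, U (T K)))"
    unfolding natural_iso_def
    using functor_id [OF C] functor_comp [OF T.functor_induced U.functor_induced C]
  proof (intro conjI ballI)
    fix K assume "K \<in> Obj ?C"
    then have K: "K \<in> S" by simp
    then show "(K, E K, U (T K)) \<in> hom ?C (OMap (map_id ?C) K)
        (OMap (map_comp ?C U.induced T.induced) K)"
      by (simp add: T.source.hom_iff T.T_in U.T_in unit)
    show "iso_arr ?C (K, E K, U (T K))"
      using K by (intro T.source.iso_arr_identity_on_arrows [of _ _ _ "E' K"])
        (auto simp: T.T_in U.T_in T.T_Arr U.T_Arr unit unit_id)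
  next
    fix x assume "x \<in> Arr ?C"
    then obtain K F L where x: "x = (K, F, L)" "K \<in> S" "L \<in> S" "P K L F"
      by (rule T.source.Arr_cases)
    have "map_comp K (E L) F = map_comp K (U.lifted (T K) (T.lifted K F L) (T L)) (E K)"
      using x graph_mapD(2) [OF T.source.graph, of K L F]
      by (intro T.source.determined [of K "U (T L)"])
        (auto simp: T.T_in U.T_in T.T_Arr unit unit_id T.lifted U.lifted
          intro: T.source.comp_closed [where L = L] T.source.comp_closed [where L = "U (T K)"])
    then show "Comp ?C (Cod ?C x, E (Cod ?C x), U (T (Cod ?C x))) (AMap (map_id ?C) x)
        = Comp ?C (AMap (map_comp ?C U.induced T.induced) x)
            (Dom ?C x, E (Dom ?C x), U (T (Dom ?C x)))"
      using x by (simp add: T.T_in U.T_in unit T.lifted U.lifted)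
  qed
  moreover have "natural_iso ?D ?D (map_comp ?D T.induced U.induced) (map_id ?D)
          (\<lambda>X. (T (U X), D X, X))"
    unfolding natural_iso_def
    using functor_id [OF D] functor_comp [OF U.functor_induced T.functor_induced D]
  proof (intro conjI ballI)
    fix X assume "X \<in> Obj ?D"
    then have X: "X \<in> S'" by simp
    then show "(T (U X), D X, X) \<in> hom ?D (OMap (map_comp ?D T.induced U.induced) X)
        (OMap (map_id ?D) X)"
      by (simp add: T.target.hom_iff T.T_in U.T_in counit)
    show "iso_arr ?D (T (U X), D X, X)"
      using X by (intro T.target.iso_arr_identity_on_arrows [of _ _ _ "D' X"])
        (auto simp: T.T_in U.T_in T.T_Arr U.T_Arr counit counit_id)
  next
    fix x assume "x \<in> Arr ?D"
    then obtain X F Y where x: "x = (X, F, Y)" "X \<in> S'" "Y \<in> S'" "P' X Y F"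
      by (rule T.target.Arr_cases)
    have "map_comp (T (U X)) (D Y) (T.lifted (U X) (U.lifted X F Y) (U Y))
        = map_comp (T (U X)) F (D X)"
      using x graph_mapD(2) [OF T.target.graph, of X Y F]
      by (intro T.target.determined [of "T (U X)" Y])
        (auto simp: T.T_in U.T_in T.T_Arr U.T_Arr counit counit_id T.lifted U.lifted
          intro: T.target.comp_closed [where L = X] T.target.comp_closed [where L = "T (U Y)"])
    then show "Comp ?D (T (U (Cod ?D x)), D (Cod ?D x), Cod ?D x)
          (AMap (map_comp ?D T.induced U.induced) x)
        = Comp ?D (AMap (map_id ?D) x) (T (U (Dom ?D x)), D (Dom ?D x), Dom ?D x)"
      using x by (simp add: T.T_in U.T_in counit T.lifted U.lifted)
  qed
  ultimately show ?thesis
    unfolding equivalent_categories_def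
    using C D T.functor_induced U.functor_induced by blast
qed

section \<open>The calculus of inverse categories\<close>

definition idempotent :: "('o, 'a, 'm) cat_scheme \<Rightarrow> 'a \<Rightarrow> bool" where
  "idempotent X e \<longleftrightarrow> e \<in> Arr X \<and> Cod X e = Dom X e \<and> e \<cdot>\<^bsub>X\<^esub> e = e"

lemma idempotentI:
  "\<lbrakk>e \<in> Arr X; Cod X e = Dom X e; e \<cdot>\<^bsub>X\<^esub> e = e\<rbrakk> \<Longrightarrow> idempotent X e"
  by (simp add: idempotent_def)

context inverse_category
begin

abbreviation inverse_arrow ("_\<^sup>\<circ>" [1000] 1000)
  where "f\<^sup>\<circ> \<equiv> inv_arr X f"

lemma inverse_arrow: "f \<in> Arr X \<Longrightarrow> is_inverse_of X f (f\<^sup>\<circ>)"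
  unfolding inv_arr_def by (rule theI' [OF unique_inverse])

lemma inv_simps [simp]:
  assumes "f \<in> Arr X"
  shows "f\<^sup>\<circ> \<in> Arr X" "Dom X (f\<^sup>\<circ>) = Cod X f" "Cod X (f\<^sup>\<circ>) = Dom X f"
  using inverse_arrow [OF assms] by (auto simp: is_inverse_of_def hom_def)

lemma inv_eqI:
  assumes "f \<in> Arr X" "g \<in> Arr X" "Dom X g = Cod X f" "Cod X g = Dom X f"
    and "f \<cdot> (g \<cdot> f) = f" "g \<cdot> (f \<cdot> g) = g"
  shows "f\<^sup>\<circ> = g"
proof -
  have "is_inverse_of X f g"
    using assms by (simp add: is_inverse_of_def hom_def assoc)
  then show ?thesis
    using unique_inverse [OF assms(1)] inverse_arrow [OF assms(1)] by blast
qed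

lemma comp_inv_comp [simp]:
  assumes "f \<in> Arr X"
  shows "f \<cdot> (f\<^sup>\<circ> \<cdot> f) = f" "f\<^sup>\<circ> \<cdot> (f \<cdot> f\<^sup>\<circ>) = f\<^sup>\<circ>"
  using inverse_arrow [OF assms] assms by (auto simp: is_inverse_of_def hom_def assoc)

lemma comp_inv_comp_absorb:
  assumes "f \<in> Arr X" "h \<in> Arr X"
  shows "Cod X h = Dom X f \<Longrightarrow> f \<cdot> (f\<^sup>\<circ> \<cdot> (f \<cdot> h)) = f \<cdot> h"
    and "Cod X h = Cod X f \<Longrightarrow> f\<^sup>\<circ> \<cdot> (f \<cdot> (f\<^sup>\<circ> \<cdot> h)) = f\<^sup>\<circ> \<cdot> h"
  using assms arg_cong [OF comp_inv_comp(1), of f "\<lambda>y. y \<cdot> h"]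
    arg_cong [OF comp_inv_comp(2), of f "\<lambda>y. y \<cdot> h"]
  by (simp_all add: assoc del: comp_inv_comp)

lemma inv_inv [simp]: "f \<in> Arr X \<Longrightarrow> f\<^sup>\<circ>\<^sup>\<circ> = f"
  by (rule inv_eqI) simp_all

lemma idempotentD [simp]:
  assumes "idempotent X e"
  shows "e \<in> Arr X" "Cod X e = Dom X e" "e \<cdot> e = e"
  using assms by (auto simp: idempotent_def)

lemma idempotent_absorb: "\<lbrakk>idempotent X e; f \<in> Arr X; Cod X f = Dom X e\<rbrakk> \<Longrightarrow> e \<cdot> (e \<cdot> f) = e \<cdot> f"
  by (metis assoc idempotentD)

lemma inv_idempotent [simp]: "idempotent X e \<Longrightarrow> e\<^sup>\<circ> = e"
  by (rule inv_eqI) simp_all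

lemma idempotent_Ident: "A \<in> Obj X \<Longrightarrow> idempotent X (Ident X A)"
  by (rule idempotentI) simp_all

text \<open>The classical argument for inverse semigroups: if \<open>x\<close> is the inverse of \<open>e d\<close>, then \<open>d x e\<close> is an
inverse of \<open>e d\<close> as well, so it equals \<open>x\<close>, which makes \<open>x\<close> idempotent. An idempotent is its own
inverse, hence \<open>e d = x\<close>.\<close>

lemma idempotent_comp:
  assumes "idempotent X e" "idempotent X d" "Dom X d = Dom X e"
  shows "idempotent X (e \<cdot> d)"
proof -
  define x where "x = (e \<cdot> d)\<^sup>\<circ>"
  have x [simp]: "x \<in> Arr X" "Dom X x = Dom X e" "Cod X x = Dom X e"
    using assms by (simp_all add: x_def)
  have 1: "e \<cdot> (d \<cdot> (x \<cdot> (e \<cdot> d))) = e \<cdot> d" and 2: "x \<cdot> (e \<cdot> (d \<cdot> x)) = x"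
    using comp_inv_comp [of "e \<cdot> d"] assms
    by (simp_all add: x_def assoc del: comp_inv_comp)
  have 3: "x \<cdot> (e \<cdot> (d \<cdot> (x \<cdot> e))) = x \<cdot> e"
    using arg_cong [OF 2, of "\<lambda>y. y \<cdot> e"] assms by (simp add: assoc)
  have "(e \<cdot> d)\<^sup>\<circ> = d \<cdot> (x \<cdot> e)"
    using assms 1 2 3 by (intro inv_eqI) (simp_all add: assoc idempotent_absorb)
  then have xeq: "d \<cdot> (x \<cdot> e) = x" unfolding x_def [symmetric] by (rule sym)
  have "idempotent X (d \<cdot> (x \<cdot> e))"
    using assms 2 3 by (intro idempotentI) (simp_all add: assoc idempotent_absorb)
  then have "x\<^sup>\<circ> = x" and "idempotent X x" by (simp_all add: xeq)
  moreover have "x\<^sup>\<circ> = e \<cdot> d"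
    using assms by (simp add: x_def)
  ultimately show ?thesis by simp
qed

text \<open>The products \<open>e d\<close> and \<open>d e\<close> are idempotent and therefore inverse to each other; but \<open>e d\<close>
is also its own inverse.\<close>

lemma idempotent_commute:
  assumes "idempotent X e" "idempotent X d" "Dom X d = Dom X e"
  shows "e \<cdot> d = d \<cdot> e"
proof -
  have i: "idempotent X (e \<cdot> d)" "idempotent X (d \<cdot> e)"
    using assms by (simp_all add: idempotent_comp)
  then have "e \<cdot> (d \<cdot> (e \<cdot> d)) = e \<cdot> d" "d \<cdot> (e \<cdot> (d \<cdot> e)) = d \<cdot> e"
    using idempotentD(3) [of "e \<cdot> d"] idempotentD(3) [of "d \<cdot> e"] assms
    by (simp_all add: assoc del: idempotentD(3))
  then have "(e \<cdot> d)\<^sup>\<circ> = d \<cdot> e"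
    using assms by (intro inv_eqI) (simp_all add: assoc idempotent_absorb)
  then show ?thesis using i by simp
qed

lemma idempotent_inv_comp [simp]: "f \<in> Arr X \<Longrightarrow> idempotent X (f\<^sup>\<circ> \<cdot> f)"
  by (rule idempotentI) (simp_all add: assoc)

lemma idempotent_comp_inv [simp]: "f \<in> Arr X \<Longrightarrow> idempotent X (f \<cdot> f\<^sup>\<circ>)"
  by (rule idempotentI) (simp_all add: assoc)

lemma bar_simps [simp]:
  assumes "f \<in> Arr X"
  shows "bar X f \<in> Arr X" "Dom X (bar X f) = Dom X f" "Cod X (bar X f) = Dom X f"
    "idempotent X (bar X f)" "f \<cdot> bar X f = f" "bar X (f\<^sup>\<circ>) \<cdot> f = f"
  using assms by (simp_all add: bar_def assoc)

lemma bar_idempotent [simp]: "idempotent X e \<Longrightarrow> bar X e = e"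
  by (simp add: bar_def)

lemma idempotent_iff_bar: "idempotent X e \<longleftrightarrow> e \<in> Arr X \<and> bar X e = e"
  by (metis bar_simps(4) bar_idempotent idempotentD(1))

lemma inv_comp [simp]:
  assumes "f \<in> Arr X" "g \<in> Arr X" "Cod X f = Dom X g"
  shows "(g \<cdot> f)\<^sup>\<circ> = f\<^sup>\<circ> \<cdot> g\<^sup>\<circ>"
proof (rule inv_eqI)
  have c: "(g\<^sup>\<circ> \<cdot> g) \<cdot> (f \<cdot> f\<^sup>\<circ>) = (f \<cdot> f\<^sup>\<circ>) \<cdot> (g\<^sup>\<circ> \<cdot> g)"
    using assms by (intro idempotent_commute) simp_all
  have "f \<cdot> (f\<^sup>\<circ> \<cdot> (g\<^sup>\<circ> \<cdot> (g \<cdot> f))) = g\<^sup>\<circ> \<cdot> (g \<cdot> f)"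
    using arg_cong [OF c, of "\<lambda>y. y \<cdot> f"] assms by (simp add: assoc)
  then show "g \<cdot> f \<cdot> (f\<^sup>\<circ> \<cdot> g\<^sup>\<circ> \<cdot> (g \<cdot> f)) = g \<cdot> f"
    using assms by (simp add: assoc comp_inv_comp_absorb)
  have "g\<^sup>\<circ> \<cdot> (g \<cdot> (f \<cdot> (f\<^sup>\<circ> \<cdot> g\<^sup>\<circ>))) = f \<cdot> (f\<^sup>\<circ> \<cdot> g\<^sup>\<circ>)"
    using arg_cong [OF c, of "\<lambda>y. y \<cdot> g\<^sup>\<circ>"] assms by (simp add: assoc)
  then show "f\<^sup>\<circ> \<cdot> g\<^sup>\<circ> \<cdot> (g \<cdot> f \<cdot> (f\<^sup>\<circ> \<cdot> g\<^sup>\<circ>)) = f\<^sup>\<circ> \<cdot> g\<^sup>\<circ>"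
    using assms by (simp add: assoc comp_inv_comp_absorb)
qed (use assms in simp_all)

end

section \<open>Ordered groupoids\<close>

context groupoid
begin

lemma ginv_ex1:
  assumes "f \<in> Arr G"
  shows "\<exists>!g. g \<in> hom G (Cod G f) (Dom G f) \<and> g \<cdot> f = Ident G (Dom G f) \<and> f \<cdot> g = Ident G (Cod G f)"
proof (rule ex_ex1I)
  show "\<exists>g. g \<in> hom G (Cod G f) (Dom G f) \<and> g \<cdot> f = Ident G (Dom G f) \<and> f \<cdot> g = Ident G (Cod G f)"
    using all_iso [OF assms] by (auto simp: iso_arr_def)
  fix g h
  assume g: "g \<in> hom G (Cod G f) (Dom G f) \<and> g \<cdot> f = Ident G (Dom G f) \<and> f \<cdot> g = Ident G (Cod G f)"
    and h: "h \<in> hom G (Cod G f) (Dom G f) \<and> h \<cdot> f = Ident G (Dom G f) \<and> f \<cdot> h = Ident G (Cod G f)"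
  then have "g \<cdot> f \<cdot> h = g \<cdot> (f \<cdot> h)"
    using assms by (intro assoc) (auto simp: hom_def)
  then show "g = h"
    using g h by (simp add: hom_def)
qed

lemma ginv_simps [simp]:
  assumes "f \<in> Arr G"
  shows "ginv G f \<in> Arr G" "Dom G (ginv G f) = Cod G f" "Cod G (ginv G f) = Dom G f"
    "ginv G f \<cdot> f = Ident G (Dom G f)" "f \<cdot> ginv G f = Ident G (Cod G f)"
  using theI' [OF ginv_ex1 [OF assms]] by (auto simp: ginv_def hom_def)

lemma ginv_eqI:
  assumes "f \<in> Arr G" "g \<in> Arr G" "Dom G g = Cod G f" "Cod G g = Dom G f"
    and "g \<cdot> f = Ident G (Dom G f)" "f \<cdot> g = Ident G (Cod G f)"
  shows "ginv G f = g"
  using ginv_ex1 [OF assms(1)] theI' [OF ginv_ex1 [OF assms(1)]] assms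
  unfolding ginv_def hom_def by blast

lemma ginv_ginv [simp]: "f \<in> Arr G \<Longrightarrow> ginv G (ginv G f) = f"
  by (rule ginv_eqI) simp_all

lemma ginv_Comp_cancel [simp]:
  "\<lbrakk>f \<in> Arr G; g \<in> Arr G; Cod G g = Dom G f\<rbrakk> \<Longrightarrow> ginv G f \<cdot> (f \<cdot> g) = g"
  "\<lbrakk>f \<in> Arr G; g \<in> Arr G; Cod G g = Cod G f\<rbrakk> \<Longrightarrow> f \<cdot> (ginv G f \<cdot> g) = g"
  by (simp_all flip: assoc)

text \<open>In a groupoid a single one of the two equations defining an inverse in an inverse category determines
the inverse, because everything can be cancelled.\<close>

lemma Comp_ginv_eq:
  assumes "f \<in> Arr G" "g \<in> Arr G" "Dom G g = Cod G f" "Cod G g = Dom G f" "f \<cdot> (g \<cdot> f) = f"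
  shows "g = ginv G f"
proof -
  have "ginv G f \<cdot> (f \<cdot> (g \<cdot> f)) = g \<cdot> f"
    using assms(1-4) by (intro ginv_Comp_cancel) simp_all
  then have "g \<cdot> f = Ident G (Dom G f)"
    using assms by simp
  then have "g \<cdot> f \<cdot> ginv G f = ginv G f"
    using assms by simp
  then show ?thesis
    using assms by (simp add: assoc)
qed

end

context ordered_groupoid
begin

lemma Le_Arr: "(f, g) \<in> Le G \<Longrightarrow> f \<in> Arr G" "(f, g) \<in> Le G \<Longrightarrow> g \<in> Arr G"
  using partial_order_onD(4) [OF Le_order] by auto

lemma Le_refl [simp]: "f \<in> Arr G \<Longrightarrow> (f, f) \<in> Le G"
  using partial_order_onD(1) [OF Le_order] by (simp add: refl_on_def)

lemma Le_trans: "\<lbrakk>(f, g) \<in> Le G; (g, h) \<in> Le G\<rbrakk> \<Longrightarrow> (f, h) \<in> Le G"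
  using partial_order_onD(2) [OF Le_order] by (blast dest: transD)

lemma Le_antisym: "\<lbrakk>(f, g) \<in> Le G; (g, f) \<in> Le G\<rbrakk> \<Longrightarrow> f = g"
  using partial_order_onD(3) [OF Le_order] by (blast dest: antisymD)

lemma obj_le_refl [simp]: "A \<in> Obj G \<Longrightarrow> obj_le G A A"
  by (simp add: obj_le_def)

lemma obj_le_trans: "\<lbrakk>obj_le G A B; obj_le G B D\<rbrakk> \<Longrightarrow> obj_le G A D"
  unfolding obj_le_def by (blast intro: Le_trans)

lemma obj_le_antisym: "\<lbrakk>obj_le G A B; obj_le G B A\<rbrakk> \<Longrightarrow> A = B"
  unfolding obj_le_def by (blast intro: Le_antisym Ident_inject)

lemma obj_le_Obj: "obj_le G A B \<Longrightarrow> A \<in> Obj G" "obj_le G A B \<Longrightarrow> B \<in> Obj G"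
  by (simp_all add: obj_le_def)

lemma Le_Dom: "(f, g) \<in> Le G \<Longrightarrow> obj_le G (Dom G f) (Dom G g)"
  using Le_Comp [OF Le_inv, of f g f g] by (simp add: obj_le_def Le_Arr Dom_in)

lemma Le_Cod: "(f, g) \<in> Le G \<Longrightarrow> obj_le G (Cod G f) (Cod G g)"
  using Le_Comp [OF _ Le_inv, of f g f g] by (simp add: obj_le_def Le_Arr Cod_in)

lemma Le_eqI_Dom: "\<lbrakk>(h, f) \<in> Le G; (k, f) \<in> Le G; Dom G h = Dom G k\<rbrakk> \<Longrightarrow> h = k"
  using restriction [of f "Dom G h"] Le_Dom [of h f] Le_Arr(2) [of h f] by metis

lemma Le_eqI_Cod: "\<lbrakk>(h, f) \<in> Le G; (k, f) \<in> Le G; Cod G h = Cod G k\<rbrakk> \<Longrightarrow> h = k"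
  using corestriction [of f "Cod G h"] Le_Cod [of h f] Le_Arr(2) [of h f] by metis

lemma restrictionE:
  assumes "f \<in> Arr G" "obj_le G A (Dom G f)"
  obtains h where "(h, f) \<in> Le G" "Dom G h = A"
  using restriction [OF assms] by blast

lemma corestrictionE:
  assumes "f \<in> Arr G" "obj_le G A (Cod G f)"
  obtains h where "(h, f) \<in> Le G" "Cod G h = A"
  using corestriction [OF assms] by blast

text \<open>Below a fixed arrow the order is that of the domains, because the restriction of \<open>k\<close> to the domain
of \<open>h\<close> is a restriction of \<open>f\<close> too.\<close>

lemma Le_if_Dom_le:
  assumes "(h, f) \<in> Le G" "(k, f) \<in> Le G" "obj_le G (Dom G h) (Dom G k)"
  shows "(h, k) \<in> Le G"
proof -
  obtain r where "(r, k) \<in> Le G" "Dom G r = Dom G h"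
    using restrictionE assms Le_Arr by metis
  then show ?thesis
    using Le_eqI_Dom [of r f h] assms Le_trans by metis
qed

lemma Le_if_Cod_le:
  assumes "(h, f) \<in> Le G" "(k, f) \<in> Le G" "obj_le G (Cod G h) (Cod G k)"
  shows "(h, k) \<in> Le G"
proof -
  obtain r where "(r, k) \<in> Le G" "Cod G r = Cod G h"
    using corestrictionE assms Le_Arr by metis
  then show ?thesis
    using Le_eqI_Cod [of r f h] assms Le_trans by metis
qed

lemma Le_Ident:
  assumes "(k, Ident G A) \<in> Le G" "A \<in> Obj G"
  shows "k = Ident G (Dom G k)"
proof (rule Le_eqI_Dom [OF assms(1)])
  show "(Ident G (Dom G k), Ident G A) \<in> Le G" "Dom G k = Dom G (Ident G (Dom G k))"
    using Le_Dom [OF assms(1)] assms(2) by (auto simp: obj_le_def)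
qed

text \<open>An arrow below a composite is again a composite, of restrictions of the factors. This is what makes
the greatest composites associative.\<close>

lemma Le_CompE:
  assumes "(k, g \<cdot> f) \<in> Le G" "f \<in> Arr G" "g \<in> Arr G" "Cod G f = Dom G g"
  obtains g' f' where "(g', g) \<in> Le G" "(f', f) \<in> Le G" "Cod G f' = Dom G g'" "k = g' \<cdot> f'"
proof -
  obtain f' where f': "(f', f) \<in> Le G" "Dom G f' = Dom G k"
    using restrictionE [OF assms(2)] Le_Dom [OF assms(1)] assms by auto
  obtain g' where g': "(g', g) \<in> Le G" "Dom G g' = Cod G f'"
    using restrictionE [OF assms(3)] Le_Cod [OF f'(1)] assms by auto
  have "k = g' \<cdot> f'"
  proof (rule Le_eqI_Dom)
    show "(k, g \<cdot> f) \<in> Le G" by fact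
    show "(g' \<cdot> f', g \<cdot> f) \<in> Le G"
      using f' g' assms by (intro Le_Comp) auto
    show "Dom G k = Dom G (g' \<cdot> f')"
      using f' g' Le_Arr by auto
  qed
  with f' g' that show thesis by metis
qed

end

section \<open>Top-heavy locally inductive groupoids\<close>

definition maximal_object :: "('o, 'a, 'm) ocat_scheme \<Rightarrow> 'o \<Rightarrow> bool" where
  "maximal_object G T \<longleftrightarrow> T \<in> Obj G \<and> (\<forall>B. obj_le G T B \<longrightarrow> B = T)"

definition top_of :: "('o, 'a, 'm) ocat_scheme \<Rightarrow> 'o \<Rightarrow> 'o" where
  "top_of G A = (THE T. maximal_object G T \<and> obj_le G A T)"

text \<open>The partition into semilattices is eliminated in favour of the order on objects: a block is the set
of objects below one maximal object, and two objects lie in a common block iff they have a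
common upper bound.\<close>

locale top_heavy_groupoid = ordered_groupoid +
  assumes unique_top: "A \<in> Obj G \<Longrightarrow> \<exists>!T. maximal_object G T \<and> obj_le G A T"
    and bounded_meet: "\<lbrakk>obj_le G A T; obj_le G B T\<rbrakk>
      \<Longrightarrow> \<exists>M. obj_le G M A \<and> obj_le G M B \<and> (\<forall>D. obj_le G D A \<and> obj_le G D B \<longrightarrow> obj_le G D M)"
begin

lemma top_of:
  assumes "A \<in> Obj G"
  shows "maximal_object G (top_of G A)" "obj_le G A (top_of G A)" "top_of G A \<in> Obj G"
proof -
  show *: "maximal_object G (top_of G A)" "obj_le G A (top_of G A)"
    using theI' [OF unique_top [OF assms]] by (simp_all add: top_of_def)
  show "top_of G A \<in> Obj G"
    by (rule obj_le_Obj(2)) fact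
qed

lemma top_of_eqI: "\<lbrakk>maximal_object G T; obj_le G A T\<rbrakk> \<Longrightarrow> top_of G A = T"
  using unique_top [of A] top_of [of A] obj_le_Obj(1) [of A T] by blast

lemma top_of_eq: "obj_le G A B \<Longrightarrow> top_of G A = top_of G B"
  by (meson obj_le_Obj(2) obj_le_trans top_of_eqI top_of(1,2))

lemma top_of_maximal [simp]: "maximal_object G T \<Longrightarrow> top_of G T = T"
  by (rule top_of_eqI) (simp_all add: maximal_object_def)

lemma meetE:
  assumes "A \<in> Obj G" "B \<in> Obj G" "top_of G A = top_of G B"
  obtains M where "obj_le G M A" "obj_le G M B"
    "\<And>D. \<lbrakk>obj_le G D A; obj_le G D B\<rbrakk> \<Longrightarrow> obj_le G D M"
  using bounded_meet [of A "top_of G A" B] top_of(2) assms by metis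

end

lemma top_heavy_groupoid_iff: "top_heavy_groupoid G \<longleftrightarrow> locally_inductive G \<and> top_heavy G"
proof
  assume "top_heavy_groupoid G"
  then interpret top_heavy_groupoid G .
  define block where "block T = {A. obj_le G A T}" for T
  define P where "P = block ` {T. maximal_object G T}"
  have in_block [simp]: "A \<in> block T \<longleftrightarrow> obj_le G A T" for A T
    by (simp add: block_def)
  have "semilattice_partition G P"
    unfolding semilattice_partition_def
  proof (intro conjI ballI allI impI)
    show "partition_on (Obj G) P"
    proof (rule partition_onI)
      show "\<Union>P = Obj G"
        using top_of(1,2) by (auto simp: P_def obj_le_Obj) blast
      show "{} \<notin> P"
        using obj_le_refl unfolding P_def maximal_object_def block_def by blast
      show "disjnt p q" if "p \<in> P" "q \<in> P" "p \<noteq> q" for p q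
        using that unfolding P_def disjnt_iff by clarsimp (metis top_of_eqI)
    qed
    fix M assume "M \<in> P"
    then obtain T where M: "M = block T" "maximal_object G T"
      by (auto simp: P_def)
    show "meet_semilattice_on M (obj_le G)"
      unfolding meet_semilattice_on_def
    proof (intro conjI ballI)
      show "partial_order_on M {(A, B). A \<in> M \<and> B \<in> M \<and> obj_le G A B}"
        by (auto simp: partial_order_on_def preorder_on_def refl_on_def trans_def antisym_def M
            obj_le_Obj intro: obj_le_trans obj_le_antisym)
      show "\<exists>D \<in> M. obj_le G D A \<and> obj_le G D B
          \<and> (\<forall>E \<in> M. obj_le G E A \<and> obj_le G E B \<longrightarrow> obj_le G E D)"
        if AB: "A \<in> M" "B \<in> M" for A B
      proof -
        have "obj_le G A T" "obj_le G B T"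
          using AB M by simp_all
        then obtain D where "obj_le G D A" "obj_le G D B"
            "\<forall>E. obj_le G E A \<and> obj_le G E B \<longrightarrow> obj_le G E D"
          using bounded_meet by blast
        moreover from this \<open>obj_le G A T\<close> have "D \<in> M"
          using M obj_le_trans by simp
        ultimately show ?thesis by blast
      qed
    qed
  next
    fix A B assume "obj_le G A B"
    moreover from this have "maximal_object G (top_of G B)" "obj_le G B (top_of G B)"
      using obj_le_Obj(2) top_of(1,2) by blast+
    ultimately show "\<exists>M \<in> P. A \<in> M \<and> B \<in> M"
      unfolding P_def using obj_le_trans [of A B "top_of G B"] in_block by blast
  qed
  moreover have "\<forall>M \<in> P. \<exists>T \<in> M. \<forall>A \<in> M. obj_le G A T"
    by (auto simp: P_def maximal_object_def)
  ultimately show "locally_inductive G \<and> top_heavy G"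
    unfolding locally_inductive_def top_heavy_def using ordered_groupoid_axioms by blast
next
  assume "locally_inductive G \<and> top_heavy G"
  then interpret ordered_groupoid G
    by (simp add: locally_inductive_def)
  obtain P where part: "partition_on (Obj G) P"
    and semi: "\<And>M. M \<in> P \<Longrightarrow> meet_semilattice_on M (obj_le G)"
    and comparable: "\<And>A B. obj_le G A B \<Longrightarrow> \<exists>M \<in> P. A \<in> M \<and> B \<in> M"
    and top: "\<And>M. M \<in> P \<Longrightarrow> \<exists>T \<in> M. \<forall>A \<in> M. obj_le G A T"
    using \<open>locally_inductive G \<and> top_heavy G\<close>
    unfolding top_heavy_def semilattice_partition_def by blast
  have same_block: "B \<in> M" if "M \<in> P" "A \<in> M" "obj_le G A B \<or> obj_le G B A" for A B M
    using comparable that partition_onD2 [OF part] unfolding disjoint_def by blast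
  show "top_heavy_groupoid G"
  proof
    fix A assume "A \<in> Obj G"
    then obtain M where M: "M \<in> P" "A \<in> M"
      using partition_onD1 [OF part] by blast
    then obtain T where T: "T \<in> M" "\<And>B. B \<in> M \<Longrightarrow> obj_le G B T"
      using top by blast
    show "\<exists>!T. maximal_object G T \<and> obj_le G A T"
    proof (rule ex1I)
      show "maximal_object G T \<and> obj_le G A T"
        using T M same_block obj_le_antisym obj_le_Obj unfolding maximal_object_def by metis
      show "T' = T" if "maximal_object G T' \<and> obj_le G A T'" for T'
        using T M same_block that unfolding maximal_object_def by metis
    qed
  next
    fix A T B assume le: "obj_le G A T" "obj_le G B T"
    then obtain M where M: "M \<in> P" "A \<in> M" "B \<in> M"
      using comparable same_block by meson
    then obtain D where D: "D \<in> M" "obj_le G D A" "obj_le G D B"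
        "\<forall>E \<in> M. obj_le G E A \<and> obj_le G E B \<longrightarrow> obj_le G E D"
      using semi unfolding meet_semilattice_on_def by meson
    then show "\<exists>D. obj_le G D A \<and> obj_le G D B
        \<and> (\<forall>E. obj_le G E A \<and> obj_le G E B \<longrightarrow> obj_le G E D)"
      using same_block M by meson
  qed
qed

section \<open>The natural order of an inverse category\<close>

context inverse_category
begin

abbreviation natural_order (infix "\<sqsubseteq>" 50)
  where "f \<sqsubseteq> g \<equiv> nat_le X f g"

lemma nat_leD:
  assumes "f \<sqsubseteq> g"
  shows "f \<in> Arr X" "g \<in> Arr X" "Dom X f = Dom X g" "Cod X f = Cod X g" "g \<cdot> bar X f = f"
  using assms by (simp_all add: nat_le_def)

text \<open>The bar measures the domain of definition, and multiplying by an idempotent on the right restricts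
it. Commutation of idempotents turns \<open>e g\<^sup>\<circ> g e\<close> into \<open>g\<^sup>\<circ> g e\<close>.\<close>

lemma bar_comp_idempotent:
  assumes "g \<in> Arr X" "idempotent X e" "Dom X e = Dom X g"
  shows "bar X (g \<cdot> e) = bar X g \<cdot> e"
proof -
  have c: "bar X g \<cdot> e = e \<cdot> bar X g"
    using assms by (intro idempotent_commute) simp_all
  have "bar X (g \<cdot> e) = e \<cdot> (bar X g \<cdot> e)"
    using assms by (simp add: bar_def assoc)
  then show ?thesis
    using assms unfolding c by (simp add: idempotent_absorb)
qed

lemma nat_le_comp_idempotent:
  assumes "g \<in> Arr X" "idempotent X e" "Dom X e = Dom X g"
  shows "g \<cdot> e \<sqsubseteq> g"
proof -
  have "g \<cdot> (bar X g \<cdot> e) = g \<cdot> e"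
    using assms by (simp flip: assoc)
  then show ?thesis
    using assms by (simp add: nat_le_def bar_comp_idempotent)
qed

text \<open>Corestriction by \<open>e\<close> is restriction by the conjugate \<open>g\<^sup>\<circ> e g\<close>, which is again idempotent.\<close>

lemma nat_le_idempotent_comp:
  assumes "g \<in> Arr X" "idempotent X e" "Dom X e = Cod X g"
  shows "e \<cdot> g \<sqsubseteq> g"
proof -
  have c: "g \<cdot> g\<^sup>\<circ> \<cdot> e = e \<cdot> (g \<cdot> g\<^sup>\<circ>)"
    using assms by (intro idempotent_commute) simp_all
  have gg: "g \<cdot> (g\<^sup>\<circ> \<cdot> (e \<cdot> g)) = e \<cdot> g"
    using arg_cong [OF c, of "\<lambda>x. x \<cdot> g"] assms by (simp add: assoc)
  have "idempotent X (g\<^sup>\<circ> \<cdot> (e \<cdot> g))"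
    using assms gg by (intro idempotentI) (simp_all add: assoc idempotent_absorb)
  then show ?thesis
    using nat_le_comp_idempotent [of g "g\<^sup>\<circ> \<cdot> (e \<cdot> g)"] assms gg by simp
qed

lemma nat_le_refl [simp]: "f \<in> Arr X \<Longrightarrow> f \<sqsubseteq> f"
  by (simp add: nat_le_def)

lemma nat_le_trans:
  assumes "f \<sqsubseteq> g" "g \<sqsubseteq> h"
  shows "f \<sqsubseteq> h"
proof -
  have "h \<cdot> (bar X g \<cdot> bar X f) \<sqsubseteq> h"
    using nat_leD [OF assms(1)] nat_leD [OF assms(2)]
    by (intro nat_le_comp_idempotent idempotent_comp) simp_all
  moreover have "h \<cdot> (bar X g \<cdot> bar X f) = f"
    using nat_leD [OF assms(1)] nat_leD [OF assms(2)] by (simp flip: assoc)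
  ultimately show ?thesis by simp
qed

lemma nat_le_antisym:
  assumes "f \<sqsubseteq> g" "g \<sqsubseteq> f"
  shows "f = g"
proof -
  have "f = f \<cdot> bar X g \<cdot> bar X f"
    using nat_leD(5) [OF assms(1)] nat_leD(5) [OF assms(2)] by simp
  also have "\<dots> = f \<cdot> (bar X f \<cdot> bar X g)"
    using nat_leD [OF assms(1)] idempotent_commute [of "bar X g" "bar X f"] by (simp add: assoc)
  also have "\<dots> = f \<cdot> bar X f \<cdot> bar X g"
    using nat_leD [OF assms(1)] by (simp add: assoc del: bar_simps(5))
  finally show ?thesis
    using nat_leD [OF assms(1)] nat_leD(5) [OF assms(2)] by simp
qed

lemma nat_le_inv:
  assumes "f \<sqsubseteq> g"
  shows "f\<^sup>\<circ> \<sqsubseteq> g\<^sup>\<circ>"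
proof -
  note f = nat_leD [OF assms]
  have "f\<^sup>\<circ> = bar X f \<cdot> g\<^sup>\<circ>"
    using f inv_comp [of "bar X f" g] by simp
  then show ?thesis
    using f nat_le_idempotent_comp [of "g\<^sup>\<circ>" "bar X f"] by simp
qed

lemma nat_le_comp:
  assumes "f \<sqsubseteq> f'" "g \<sqsubseteq> g'" "Cod X f = Dom X g"
  shows "g \<cdot> f \<sqsubseteq> g' \<cdot> f'"
proof -
  note f = nat_leD [OF assms(1)] and g = nat_leD [OF assms(2)]
  \<comment> \<open>The idempotent between the two factors is moved to the right of \<open>f'\<close>, where it becomes \<open>e\<close>.\<close>
  have "bar X g \<cdot> f' \<sqsubseteq> f'"
    using f g assms(3) by (intro nat_le_idempotent_comp) simp_all
  moreover define e where "e = bar X (bar X g \<cdot> f')"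
  ultimately have e: "idempotent X e" "Dom X e = Dom X f'" "f' \<cdot> e = bar X g \<cdot> f'"
    using f g assms(3) nat_leD(5) [of "bar X g \<cdot> f'" f'] by simp_all
  have "g \<cdot> f = g' \<cdot> bar X g \<cdot> (f' \<cdot> bar X f)"
    using f g by simp
  also have "\<dots> = g' \<cdot> (bar X g \<cdot> f' \<cdot> bar X f)"
    using f(1-4) g(1-4) assms(3) by (simp add: assoc)
  also have "\<dots> = g' \<cdot> f' \<cdot> (e \<cdot> bar X f)"
    unfolding e(3) [symmetric] using f(1-4) g(1-4) e(1,2) assms(3) by (simp add: assoc)
  also have "\<dots> \<sqsubseteq> g' \<cdot> f'"
    using f g assms(3) e by (intro nat_le_comp_idempotent idempotent_comp) simp_all
  finally show ?thesis .
qed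

lemma nat_le_bar: "f \<sqsubseteq> g \<Longrightarrow> bar X f \<sqsubseteq> bar X g"
  using nat_le_comp [of f g "f\<^sup>\<circ>" "g\<^sup>\<circ>"] nat_le_inv [of f g] nat_leD(1) [of f g] by (simp add: bar_def)

lemma bar_comp_le:
  assumes "f \<in> Arr X" "g \<in> Arr X" "Cod X f = Dom X g"
  shows "bar X (g \<cdot> f) \<sqsubseteq> bar X f"
proof -
  have "f\<^sup>\<circ> \<cdot> (bar X g \<cdot> f) \<sqsubseteq> f\<^sup>\<circ> \<cdot> f"
    using assms by (intro nat_le_comp nat_le_idempotent_comp) simp_all
  then show ?thesis
    using assms by (simp add: bar_def assoc)
qed

text \<open>The smaller arrow is the restriction of the larger one to its own bar, so comparable arrows with the
same domain of definition agree.\<close>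

lemma nat_le_eqI:
  assumes "f \<sqsubseteq> g" "bar X g \<sqsubseteq> bar X f"
  shows "f = g"
proof -
  have "bar X f = bar X g"
    by (rule nat_le_antisym [OF nat_le_bar]) fact+
  then have "g \<cdot> bar X g = f"
    using nat_leD(5) [OF assms(1)] by simp
  then show ?thesis
    using nat_leD(2) [OF assms(1)] by simp
qed

end

section \<open>The groupoid of an inverse category\<close>

text \<open>All idempotents are taken as objects; they are exactly the bars of arrows, since an idempotent is its
own bar.\<close>

definition groupoid_of :: "('o, 'a, 'm) cat_scheme \<Rightarrow> ('a, 'a) ocat" where
  "groupoid_of X =
     \<lparr>Obj = {e. idempotent X e},
      Arr = Arr X,
      Dom = (\<lambda>f \<in> Arr X. bar X f),
      Cod = (\<lambda>f \<in> Arr X. bar X (inv_arr X f)),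
      Ident = (\<lambda>e \<in> {e. idempotent X e}. e),
      Comp = (\<lambda>g f. if f \<in> Arr X \<and> g \<in> Arr X \<and> bar X (inv_arr X f) = bar X g
        then g \<cdot>\<^bsub>X\<^esub> f else undefined),
      Le = {(f, g). nat_le X f g}\<rparr>"

lemma groupoid_of_simps [simp]:
  "Obj (groupoid_of X) = {e. idempotent X e}"
  "Arr (groupoid_of X) = Arr X"
  "f \<in> Arr X \<Longrightarrow> Dom (groupoid_of X) f = bar X f"
  "f \<in> Arr X \<Longrightarrow> Cod (groupoid_of X) f = bar X (inv_arr X f)"
  "idempotent X e \<Longrightarrow> Ident (groupoid_of X) e = e"
  "\<lbrakk>f \<in> Arr X; g \<in> Arr X; bar X (inv_arr X f) = bar X g\<rbrakk> \<Longrightarrow> g \<cdot>\<^bsub>groupoid_of X\<^esub> f = g \<cdot>\<^bsub>X\<^esub> f"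
  "(f, g) \<in> Le (groupoid_of X) \<longleftrightarrow> nat_le X f g"
  by (simp_all add: groupoid_of_def)

context inverse_category
begin

lemma composable_in_groupoid:
  assumes "f \<in> Arr X" "g \<in> Arr X" "bar X (f\<^sup>\<circ>) = bar X g"
  shows "Cod X f = Dom X g" "bar X (g \<cdot> f) = bar X f" "bar X ((g \<cdot> f)\<^sup>\<circ>) = bar X (g\<^sup>\<circ>)"
proof -
  show [simp]: "Cod X f = Dom X g"
    using assms by (metis bar_simps(2) inv_simps(1,2))
  have eq: "f \<cdot> f\<^sup>\<circ> = g\<^sup>\<circ> \<cdot> g"
    using assms by (simp add: bar_def)
  have "f\<^sup>\<circ> \<cdot> (g\<^sup>\<circ> \<cdot> g) \<cdot> f = f\<^sup>\<circ> \<cdot> f"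
    unfolding eq [symmetric] using assms(1,2) by (simp add: assoc)
  then show "bar X (g \<cdot> f) = bar X f"
    using assms(1,2) by (simp add: bar_def assoc)
  have "g \<cdot> (f \<cdot> f\<^sup>\<circ>) \<cdot> g\<^sup>\<circ> = g \<cdot> g\<^sup>\<circ>"
    unfolding eq using assms(1,2) by (simp add: assoc)
  then show "bar X ((g \<cdot> f)\<^sup>\<circ>) = bar X (g\<^sup>\<circ>)"
    using assms(1,2) by (simp add: bar_def assoc)
qed

lemma category_groupoid_of: "category (groupoid_of X)"
proof (unfold_locales, goal_cases)
  \<comment> \<open>the value of undefined composites\<close>
  case (11 f g)
  then show ?case by (auto simp: groupoid_of_def)
qed (auto simp: hom_def composable_in_groupoid assoc, auto simp: groupoid_of_def)

lemma ordered_groupoid_groupoid_of: "ordered_groupoid (groupoid_of X)"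
proof -
  interpret G: category "groupoid_of X"
    by (rule category_groupoid_of)
  interpret G: groupoid "groupoid_of X"
  proof
    fix f assume "f \<in> Arr (groupoid_of X)"
    then show "iso_arr (groupoid_of X) f"
      by (auto simp: iso_arr_def hom_def intro!: exI [of _ "f\<^sup>\<circ>"])
        (simp_all add: bar_def)
  qed
  have ginv: "ginv (groupoid_of X) f = f\<^sup>\<circ>" if "f \<in> Arr X" for f
    using that by (intro G.ginv_eqI) (simp_all, simp_all add: bar_def)
  have obj_le: "obj_le (groupoid_of X) e d \<longleftrightarrow> idempotent X e \<and> idempotent X d \<and> e \<sqsubseteq> d" for e d
    by (auto simp: obj_le_def)
  have restriction: "\<exists>!h. (h, f) \<in> Le (groupoid_of X) \<and> Dom (groupoid_of X) h = e"
    if "f \<in> Arr X" "idempotent X e" "e \<sqsubseteq> bar X f" for f e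
  proof (intro ex1I conjI)
    have e: "Dom X e = Dom X f" "bar X f \<cdot> e = e"
      using nat_leD(3,5) [OF that(3)] that by simp_all
    show "(f \<cdot> e, f) \<in> Le (groupoid_of X)" "Dom (groupoid_of X) (f \<cdot> e) = e"
      using that e by (simp_all add: nat_le_comp_idempotent bar_comp_idempotent)
    show "h = f \<cdot> e" if "(h, f) \<in> Le (groupoid_of X) \<and> Dom (groupoid_of X) h = e" for h
      using that nat_leD(1,5) [of h f] by auto
  qed
  show ?thesis
  proof
    show "partial_order_on (Arr (groupoid_of X)) (Le (groupoid_of X))"
      by (auto simp: partial_order_on_def preorder_on_def refl_on_def trans_def antisym_def
          intro: nat_leD nat_le_trans nat_le_antisym)
  next
    fix f g assume "(f, g) \<in> Le (groupoid_of X)"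
    then show "(ginv (groupoid_of X) f, ginv (groupoid_of X) g) \<in> Le (groupoid_of X)"
      by (simp add: ginv nat_leD nat_le_inv)
  next
    fix a a' b b'
    assume "(a, a') \<in> Le (groupoid_of X)" "(b, b') \<in> Le (groupoid_of X)"
      "Cod (groupoid_of X) b = Dom (groupoid_of X) a"
      "Cod (groupoid_of X) b' = Dom (groupoid_of X) a'"
    then show "(Comp (groupoid_of X) a b, Comp (groupoid_of X) a' b') \<in> Le (groupoid_of X)"
      using nat_leD(1,2) [of a a'] nat_leD(1,2) [of b b'] composable_in_groupoid(1) [of b a]
      by (simp add: nat_le_comp)
  next
    fix f e
    assume "f \<in> Arr (groupoid_of X)" and "obj_le (groupoid_of X) e (Dom (groupoid_of X) f)"
    then show "\<exists>!h. (h, f) \<in> Le (groupoid_of X) \<and> Dom (groupoid_of X) h = e"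
      by (intro restriction) (simp_all add: obj_le)
  next
    fix f e
    assume f: "f \<in> Arr (groupoid_of X)" and "obj_le (groupoid_of X) e (Cod (groupoid_of X) f)"
    then have ex: "\<exists>!h. (h, f\<^sup>\<circ>) \<in> Le (groupoid_of X) \<and> Dom (groupoid_of X) h = e"
      by (intro restriction) (simp_all add: obj_le)
    then obtain h where h: "h \<sqsubseteq> f\<^sup>\<circ>" "Dom (groupoid_of X) h = e"
      and unique: "\<And>k. k \<sqsubseteq> f\<^sup>\<circ> \<Longrightarrow> Dom (groupoid_of X) k = e \<Longrightarrow> k = h"
      unfolding groupoid_of_simps by blast
    show "\<exists>!h. (h, f) \<in> Le (groupoid_of X) \<and> Cod (groupoid_of X) h = e"
    proof (intro ex1I conjI)
      show "(h\<^sup>\<circ>, f) \<in> Le (groupoid_of X)" "Cod (groupoid_of X) (h\<^sup>\<circ>) = e"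
        using nat_le_inv [OF h(1)] h nat_leD(1) [OF h(1)] f by simp_all
      fix k assume k: "(k, f) \<in> Le (groupoid_of X) \<and> Cod (groupoid_of X) k = e"
      then have "k \<in> Arr X" "k\<^sup>\<circ> = h"
        using nat_leD(1) [of k f] by (auto intro!: unique nat_le_inv)
      then show "k = h\<^sup>\<circ>"
        by (metis inv_inv)
    qed
  qed
qed

lemma obj_le_groupoid_of:
  "obj_le (groupoid_of X) e d \<longleftrightarrow> idempotent X e \<and> idempotent X d \<and> e \<sqsubseteq> d"
  by (auto simp: obj_le_def)

lemma idempotent_le_Ident: "idempotent X e \<Longrightarrow> e \<sqsubseteq> Ident X (Dom X e)"
  by (simp add: nat_le_def Dom_in)

text \<open>Identities are the tops of the semilattices of idempotents, so the objects of \<open>X\<close> can be recovered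
from the order alone.\<close>

lemma maximal_object_groupoid_of:
  "maximal_object (groupoid_of X) T \<longleftrightarrow> (\<exists>A \<in> Obj X. T = Ident X A)"
proof
  assume "maximal_object (groupoid_of X) T"
  then have "idempotent X T" "Ident X (Dom X T) = T"
    unfolding maximal_object_def obj_le_groupoid_of
    by (auto simp: idempotent_le_Ident idempotent_Ident Dom_in)
  then show "\<exists>A \<in> Obj X. T = Ident X A"
    by (metis Dom_in idempotentD(1))
next
  assume "\<exists>A \<in> Obj X. T = Ident X A"
  then obtain A where A: "A \<in> Obj X" "T = Ident X A"
    by blast
  have "d = T" if d: "idempotent X d" "T \<sqsubseteq> d" for d
    using nat_leD(3,4,5) [OF d(2)] d(1) A idempotent_Ident [OF A(1)] by simp
  then show "maximal_object (groupoid_of X) T"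
    using A by (simp add: maximal_object_def obj_le_groupoid_of idempotent_Ident)
qed

text \<open>The meet of two idempotents is their product.\<close>

lemma top_heavy_groupoid_of: "top_heavy_groupoid (groupoid_of X)"
proof -
  interpret G: ordered_groupoid "groupoid_of X"
    by (rule ordered_groupoid_groupoid_of)
  show ?thesis
  proof
    fix e assume "e \<in> Obj (groupoid_of X)"
    then have e: "idempotent X e" by simp
    show "\<exists>!T. maximal_object (groupoid_of X) T \<and> obj_le (groupoid_of X) e T"
    proof (rule ex1I)
      show "maximal_object (groupoid_of X) (Ident X (Dom X e))
          \<and> obj_le (groupoid_of X) e (Ident X (Dom X e))"
        using e by (auto simp: maximal_object_groupoid_of obj_le_groupoid_of Dom_in
            idempotent_Ident idempotent_le_Ident)
      show "T = Ident X (Dom X e)"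
        if "maximal_object (groupoid_of X) T \<and> obj_le (groupoid_of X) e T" for T
        using that nat_leD(3) [of e T]
        by (auto simp: maximal_object_groupoid_of obj_le_groupoid_of)
    qed
  next
    fix e t d assume le: "obj_le (groupoid_of X) e t" "obj_le (groupoid_of X) d t"
    then have ed: "idempotent X e" "idempotent X d" "Dom X d = Dom X e"
      using nat_leD(3) [of e t] nat_leD(3) [of d t] by (simp_all add: obj_le_groupoid_of)
    have "obj_le (groupoid_of X) c (e \<cdot> d)"
      if "obj_le (groupoid_of X) c e" "obj_le (groupoid_of X) c d" for c
    proof -
      have c: "idempotent X c" "c \<sqsubseteq> e" "c \<sqsubseteq> d"
        using that by (simp_all add: obj_le_groupoid_of)
      then have "c \<cdot> c \<sqsubseteq> e \<cdot> d"
        by (intro nat_le_comp) simp_all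
      then show ?thesis
        using c ed by (simp add: obj_le_groupoid_of idempotent_comp)
    qed
    moreover have "obj_le (groupoid_of X) (e \<cdot> d) e" "obj_le (groupoid_of X) (e \<cdot> d) d"
      using ed by (simp_all add: obj_le_groupoid_of idempotent_comp nat_le_comp_idempotent
          nat_le_idempotent_comp)
    ultimately show "\<exists>m. obj_le (groupoid_of X) m e \<and> obj_le (groupoid_of X) m d \<and>
        (\<forall>c. obj_le (groupoid_of X) c e \<and> obj_le (groupoid_of X) c d
           \<longrightarrow> obj_le (groupoid_of X) c m)"
      by blast
  qed
qed

lemma top_of_groupoid_of:
  assumes "idempotent X e"
  shows "top_of (groupoid_of X) e = Ident X (Dom X e)"
  using assms
  by (intro top_heavy_groupoid.top_of_eqI [OF top_heavy_groupoid_of])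
    (auto simp: maximal_object_groupoid_of obj_le_groupoid_of Dom_in idempotent_Ident
      idempotent_le_Ident)

end

section \<open>The pseudo-product\<close>

definition composites_below :: "('o, 'a, 'm) ocat_scheme \<Rightarrow> 'a \<Rightarrow> 'a \<Rightarrow> 'a set" where
  "composites_below G g f =
     {g' \<cdot>\<^bsub>G\<^esub> f' | g' f'. (g', g) \<in> Le G \<and> (f', f) \<in> Le G \<and> Cod G f' = Dom G g'}"

text \<open>Ehresmann's pseudo-product. It is usually given by the formula \<open>[g|\<^sub>*M][M \<^sub>*|f]\<close>, where \<open>M\<close>
is the meet of the codomain of \<open>f\<close> and the domain of \<open>g\<close>; describing it by maximality spares computing
with meets.\<close>

definition pseudo_product :: "('o, 'a, 'm) ocat_scheme \<Rightarrow> 'a \<Rightarrow> 'a \<Rightarrow> 'a" where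
  "pseudo_product G g f =
     (THE k. k \<in> composites_below G g f \<and> (\<forall>k' \<in> composites_below G g f. (k', k) \<in> Le G))"

lemma composites_belowI:
  "\<lbrakk>(g', g) \<in> Le G; (f', f) \<in> Le G; Cod G f' = Dom G g'; k = g' \<cdot>\<^bsub>G\<^esub> f'\<rbrakk>
     \<Longrightarrow> k \<in> composites_below G g f"
  by (auto simp: composites_below_def)

context top_heavy_groupoid
begin

abbreviation pseudo_product_syntax (infixr "\<otimes>" 70)
  where "g \<otimes> f \<equiv> pseudo_product G g f"

lemma pseudo_product_eqI:
  assumes "k \<in> composites_below G g f" "\<And>k'. k' \<in> composites_below G g f \<Longrightarrow> (k', k) \<in> Le G"
  shows "g \<otimes> f = k"
  unfolding pseudo_product_def using assms by (blast intro: Le_antisym)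

text \<open>Existence of the greatest composite: a composite \<open>g' f'\<close> below \<open>g\<close> and \<open>f\<close> is composed at an object below
both the codomain of \<open>f\<close> and the domain of \<open>g\<close>, hence below their meet \<open>M\<close>.\<close>

lemma pseudo_product:
  assumes "f \<in> Arr G" "g \<in> Arr G" "top_of G (Cod G f) = top_of G (Dom G g)"
  shows pseudo_product_below: "g \<otimes> f \<in> composites_below G g f"
    and pseudo_product_greatest: "k \<in> composites_below G g f \<Longrightarrow> (k, g \<otimes> f) \<in> Le G"
proof -
  obtain M where M: "obj_le G M (Cod G f)" "obj_le G M (Dom G g)"
    "\<And>D. \<lbrakk>obj_le G D (Cod G f); obj_le G D (Dom G g)\<rbrakk> \<Longrightarrow> obj_le G D M"
    using meetE assms Dom_in Cod_in by metis
  obtain g\<^sub>M where g: "(g\<^sub>M, g) \<in> Le G" "Dom G g\<^sub>M = M"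
    using restrictionE assms M by metis
  obtain f\<^sub>M where f: "(f\<^sub>M, f) \<in> Le G" "Cod G f\<^sub>M = M"
    using corestrictionE assms M by metis
  have below: "g\<^sub>M \<cdot> f\<^sub>M \<in> composites_below G g f"
    using f g by (auto intro: composites_belowI)
  have greatest: "(k, g\<^sub>M \<cdot> f\<^sub>M) \<in> Le G" if k0: "k \<in> composites_below G g f" for k
  proof -
    obtain g' f' where k: "(g', g) \<in> Le G" "(f', f) \<in> Le G" "Cod G f' = Dom G g'" "k = g' \<cdot> f'"
      using k0 by (auto simp: composites_below_def)
    then have "obj_le G (Dom G g') M"
      using M(3) Le_Dom Le_Cod by metis
    then have "(g', g\<^sub>M) \<in> Le G" "(f', f\<^sub>M) \<in> Le G"
      using f g k by (auto intro: Le_if_Dom_le Le_if_Cod_le)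
    then show ?thesis
      unfolding k(4) using f g k(3) by (intro Le_Comp) auto
  qed
  have "g \<otimes> f = g\<^sub>M \<cdot> f\<^sub>M"
    using below greatest by (rule pseudo_product_eqI)
  then show "g \<otimes> f \<in> composites_below G g f"
    and "k \<in> composites_below G g f \<Longrightarrow> (k, g \<otimes> f) \<in> Le G"
    using below greatest by simp_all
qed

lemma pseudo_productE:
  assumes "f \<in> Arr G" "g \<in> Arr G" "top_of G (Cod G f) = top_of G (Dom G g)"
  obtains g' f' where "(g', g) \<in> Le G" "(f', f) \<in> Le G" "Cod G f' = Dom G g'" "g \<otimes> f = g' \<cdot> f'"
  using pseudo_product_below [OF assms] by (auto simp: composites_below_def)

lemma pseudo_product_simps [simp]:
  assumes "f \<in> Arr G" "g \<in> Arr G" "top_of G (Cod G f) = top_of G (Dom G g)"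
  shows "g \<otimes> f \<in> Arr G" "top_of G (Dom G (g \<otimes> f)) = top_of G (Dom G f)"
    "top_of G (Cod G (g \<otimes> f)) = top_of G (Cod G g)"
proof -
  obtain g' f' where *: "(g', g) \<in> Le G" "(f', f) \<in> Le G" "Cod G f' = Dom G g'" "g \<otimes> f = g' \<cdot> f'"
    using pseudo_productE [OF assms] .
  then have "g' \<in> Arr G" "f' \<in> Arr G"
    using Le_Arr by blast+
  with * show "g \<otimes> f \<in> Arr G" "top_of G (Dom G (g \<otimes> f)) = top_of G (Dom G f)"
    "top_of G (Cod G (g \<otimes> f)) = top_of G (Cod G g)"
    using top_of_eq Le_Dom Le_Cod by auto
qed

lemma pseudo_product_composable:
  assumes "f \<in> Arr G" "g \<in> Arr G" "Cod G f = Dom G g"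
  shows "g \<otimes> f = g \<cdot> f"
proof (rule pseudo_product_eqI)
  show "g \<cdot> f \<in> composites_below G g f"
    using assms by (intro composites_belowI [of g _ _ f]) simp_all
  show "(k, g \<cdot> f) \<in> Le G" if "k \<in> composites_below G g f" for k
    using that assms by (auto simp: composites_below_def intro: Le_Comp)
qed

lemma below_Comp_Ident:
  assumes "A \<in> Obj G" "k \<in> composites_below G g (Ident G A)"
  obtains g' where "k = g'" "(g', g) \<in> Le G" "obj_le G (Dom G g') A"
proof -
  obtain g' e where k: "(g', g) \<in> Le G" "(e, Ident G A) \<in> Le G" "Cod G e = Dom G g'" "k = g' \<cdot> e"
    using assms(2) by (auto simp: composites_below_def)
  have e: "e = Ident G (Dom G e)" "obj_le G (Dom G e) A"
    using Le_Ident [OF k(2) assms(1)] Le_Dom [OF k(2)] assms(1) by simp_all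
  then have "Dom G e = Dom G g'"
    using k(3) by (metis Ident_simps(3) obj_le_Obj(1))
  then show thesis
    using that [of g'] k e Le_Arr by (metis Comp_Ident_Dom)
qed

text \<open>The object \<open>A\<close> may be larger than the domain of \<open>f\<close>. For a maximal object this says that its
identity is neutral for the pseudo-product.\<close>

lemma pseudo_product_Ident:
  assumes "f \<in> Arr G" "obj_le G (Dom G f) A"
  shows "f \<otimes> Ident G A = f"
proof (rule pseudo_product_eqI)
  show "f \<in> composites_below G f (Ident G A)"
    using assms by (intro composites_belowI [of f f _ "Ident G (Dom G f)"]) (auto simp: obj_le_def)
  show "(k, f) \<in> Le G" if "k \<in> composites_below G f (Ident G A)" for k
    using below_Comp_Ident that assms(2) obj_le_Obj by metis
qed

lemma Ident_pseudo_product: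
  assumes "f \<in> Arr G" "obj_le G (Cod G f) A"
  shows "Ident G A \<otimes> f = f"
proof (rule pseudo_product_eqI)
  show "f \<in> composites_below G (Ident G A) f"
    using assms by (intro composites_belowI [of "Ident G (Cod G f)" _ _ f]) (auto simp: obj_le_def)
  fix k assume "k \<in> composites_below G (Ident G A) f"
  then obtain e f' where k: "(e, Ident G A) \<in> Le G" "(f', f) \<in> Le G" "Cod G f' = Dom G e" "k = e \<cdot> f'"
    by (auto simp: composites_below_def)
  then have "e = Ident G (Cod G f')"
    using Le_Ident obj_le_Obj(2) [OF assms(2)] by metis
  then have "k = f'"
    using k Le_Arr by (metis Ident_Cod_Comp)
  then show "(k, f) \<in> Le G"
    using k by simp
qed

lemma pseudo_product_Ident_le:
  assumes "g \<in> Arr G" "A \<in> Obj G" "top_of G A = top_of G (Dom G g)"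
  shows "(g \<otimes> Ident G A, g) \<in> Le G"
  using below_Comp_Ident [OF assms(2) pseudo_product_below] assms by (metis Ident_simps(1,3))

lemma restriction_as_pseudo_product:
  assumes "(f, g) \<in> Le G"
  shows "g \<otimes> Ident G (Dom G f) = f"
proof (rule pseudo_product_eqI)
  show "f \<in> composites_below G g (Ident G (Dom G f))"
    using assms Le_Arr [OF assms] Dom_in
    by (intro composites_belowI [of f _ _ "Ident G (Dom G f)"]) auto
  show "(k, f) \<in> Le G" if "k \<in> composites_below G g (Ident G (Dom G f))" for k
    using below_Comp_Ident [OF _ that] assms Le_Arr Dom_in Le_if_Dom_le by metis
qed

lemma pseudo_product3E:
  assumes "f \<in> Arr G" "g \<in> Arr G" "h \<in> Arr G"
    and "top_of G (Cod G f) = top_of G (Dom G g)" "top_of G (Cod G g) = top_of G (Dom G h)"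
  obtains h' g' f' where "(h', h) \<in> Le G" "(g', g) \<in> Le G" "(f', f) \<in> Le G"
    "Cod G f' = Dom G g'" "Cod G g' = Dom G h'" "h \<otimes> g \<otimes> f = h' \<cdot> (g' \<cdot> f')"
proof -
  obtain h' k where k: "(h', h) \<in> Le G" "(k, g \<otimes> f) \<in> Le G" "Cod G k = Dom G h'"
      "h \<otimes> g \<otimes> f = h' \<cdot> k"
    using pseudo_productE [of "g \<otimes> f" h] assms by auto
  obtain g1 f1 where 1: "(g1, g) \<in> Le G" "(f1, f) \<in> Le G" "Cod G f1 = Dom G g1" "g \<otimes> f = g1 \<cdot> f1"
    using pseudo_productE [of f g] assms by auto
  then obtain g' f' where "(g', g1) \<in> Le G" "(f', f1) \<in> Le G" "Cod G f' = Dom G g'" "k = g' \<cdot> f'"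
    using Le_CompE k(2) Le_Arr by metis
  with that [of h' g' f'] k 1 Le_Arr Le_trans show thesis
    by (metis Comp_simps(3))
qed

text \<open>Each side has the form \<open>h' (g' f')\<close> with \<open>h' \<le> h\<close>, \<open>g' \<le> g\<close>, \<open>f' \<le> f\<close>, and each side is above all
composites of this form; so each is below the other.\<close>

lemma pseudo_product_assoc:
  assumes "f \<in> Arr G" "g \<in> Arr G" "h \<in> Arr G"
    and "top_of G (Cod G f) = top_of G (Dom G g)" "top_of G (Cod G g) = top_of G (Dom G h)"
  shows "(h \<otimes> g) \<otimes> f = h \<otimes> g \<otimes> f"
proof (rule Le_antisym)
  obtain h' g' f' where k: "(h', h) \<in> Le G" "(g', g) \<in> Le G" "(f', f) \<in> Le G"
      "Cod G f' = Dom G g'" "Cod G g' = Dom G h'" "h \<otimes> g \<otimes> f = h' \<cdot> (g' \<cdot> f')"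
    using pseudo_product3E [OF assms] .
  then have arr: "h' \<in> Arr G" "g' \<in> Arr G" "f' \<in> Arr G"
    using Le_Arr by blast+
  have "(h' \<cdot> g', h \<otimes> g) \<in> Le G"
    using assms k by (intro pseudo_product_greatest) (auto intro: composites_belowI)
  then have "(h' \<cdot> g' \<cdot> f', (h \<otimes> g) \<otimes> f) \<in> Le G"
    using assms k arr by (intro pseudo_product_greatest) (auto intro: composites_belowI)
  then show "(h \<otimes> g \<otimes> f, (h \<otimes> g) \<otimes> f) \<in> Le G"
    using k arr by (simp add: assoc)
next
  obtain k f' where k: "(k, h \<otimes> g) \<in> Le G" "(f', f) \<in> Le G" "Cod G f' = Dom G k"
      "(h \<otimes> g) \<otimes> f = k \<cdot> f'"
    using pseudo_productE [of f "h \<otimes> g"] assms by auto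
  obtain h1 g1 where 1: "(h1, h) \<in> Le G" "(g1, g) \<in> Le G" "Cod G g1 = Dom G h1" "h \<otimes> g = h1 \<cdot> g1"
    using pseudo_productE [of g h] assms by auto
  then obtain h' g' where 2: "(h', h1) \<in> Le G" "(g', g1) \<in> Le G" "Cod G g' = Dom G h'" "k = h' \<cdot> g'"
    using Le_CompE k(1) Le_Arr by metis
  then have le: "(h', h) \<in> Le G" "(g', g) \<in> Le G"
    using 1 Le_trans by blast+
  then have arr: "h' \<in> Arr G" "g' \<in> Arr G" "f' \<in> Arr G"
    using k Le_Arr by blast+
  have "(g' \<cdot> f', g \<otimes> f) \<in> Le G"
    using assms k 2 le arr by (intro pseudo_product_greatest) (auto intro: composites_belowI)
  then have "(h' \<cdot> (g' \<cdot> f'), h \<otimes> g \<otimes> f) \<in> Le G"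
    using assms k 2 le arr by (intro pseudo_product_greatest) (auto intro: composites_belowI)
  then show "((h \<otimes> g) \<otimes> f, h \<otimes> g \<otimes> f) \<in> Le G"
    using k 2 arr by (simp add: assoc)
qed

text \<open>The value \<open>f\<close> of the triple pseudo-product is a composite \<open>f1 g' f2\<close> of restrictions. Since \<open>f2\<close> has
the domain of \<open>f\<close> and \<open>f1\<close> its codomain, neither is a proper restriction, so \<open>f = f g' f\<close> in the
groupoid and \<open>g'\<close> is the inverse of \<open>f\<close>. Applied to both equations defining an inverse, this yields
uniqueness of inverses for the pseudo-product.\<close>

lemma ginv_le_if_pseudo_regular:
  assumes "f \<in> Arr G" "g \<in> Arr G"
    and "top_of G (Cod G f) = top_of G (Dom G g)" "top_of G (Cod G g) = top_of G (Dom G f)"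
    and "f \<otimes> g \<otimes> f = f"
  shows "(ginv G f, g) \<in> Le G"
proof -
  obtain f1 g' f2 where k: "(f1, f) \<in> Le G" "(g', g) \<in> Le G" "(f2, f) \<in> Le G"
      "Cod G f2 = Dom G g'" "Cod G g' = Dom G f1" "f \<otimes> g \<otimes> f = f1 \<cdot> (g' \<cdot> f2)"
    using pseudo_product3E [of f g f] assms by metis
  then have arr: "f1 \<in> Arr G" "g' \<in> Arr G" "f2 \<in> Arr G"
    using Le_Arr by blast+
  have f: "f = f1 \<cdot> (g' \<cdot> f2)"
    using k assms by simp
  then have "Dom G f2 = Dom G f" "Cod G f1 = Cod G f"
    using k arr by (metis Comp_simps)+
  then have eq: "f2 = f" "f1 = f"
    using Le_eqI_Dom [of f2 f f] Le_eqI_Cod [of f1 f f] k assms(1) by simp_all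
  have "f \<cdot> (g' \<cdot> f) = f"
    using f unfolding eq by (rule sym)
  then have "g' = ginv G f"
    using k(4,5) arr(2) assms(1) unfolding eq by (intro Comp_ginv_eq) simp_all
  then show ?thesis
    using k by simp
qed

end

section \<open>The inverse category of a top-heavy locally inductive groupoid\<close>

definition inverse_category_of :: "('o, 'a, 'm) ocat_scheme \<Rightarrow> ('o, 'a) cat" where
  "inverse_category_of G =
     \<lparr>Obj = {T. maximal_object G T},
      Arr = Arr G,
      Dom = (\<lambda>f \<in> Arr G. top_of G (Dom G f)),
      Cod = (\<lambda>f \<in> Arr G. top_of G (Cod G f)),
      Ident = (\<lambda>T \<in> {T. maximal_object G T}. Ident G T),
      Comp = (\<lambda>g f. if f \<in> Arr G \<and> g \<in> Arr G \<and> top_of G (Cod G f) = top_of G (Dom G g)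
        then pseudo_product G g f else undefined)\<rparr>"

lemma inverse_category_of_simps [simp]:
  "Obj (inverse_category_of G) = {T. maximal_object G T}"
  "Arr (inverse_category_of G) = Arr G"
  "f \<in> Arr G \<Longrightarrow> Dom (inverse_category_of G) f = top_of G (Dom G f)"
  "f \<in> Arr G \<Longrightarrow> Cod (inverse_category_of G) f = top_of G (Cod G f)"
  "maximal_object G T \<Longrightarrow> Ident (inverse_category_of G) T = Ident G T"
  "\<lbrakk>f \<in> Arr G; g \<in> Arr G; top_of G (Cod G f) = top_of G (Dom G g)\<rbrakk>
     \<Longrightarrow> g \<cdot>\<^bsub>inverse_category_of G\<^esub> f = pseudo_product G g f"
  by (simp_all add: inverse_category_of_def)

context top_heavy_groupoid
begin

lemma maximal_object_Obj: "maximal_object G T \<Longrightarrow> T \<in> Obj G"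
  by (simp add: maximal_object_def)

lemma category_inverse_category_of: "category (inverse_category_of G)"
proof (unfold_locales, goal_cases)
  \<comment> \<open>Neutrality of identities: a domain lies below the top that serves as the new domain.\<close>
  case (5 f S T)
  then show ?case
    by (auto simp: hom_def top_of Dom_in intro!: pseudo_product_Ident)
next
  case (6 f S T)
  then show ?case
    by (auto simp: hom_def top_of Cod_in maximal_object_Obj intro!: Ident_pseudo_product)
next
  \<comment> \<open>the value of undefined composites\<close>
  case (11 f g)
  then show ?case by (auto simp: inverse_category_of_def)
qed (auto simp: hom_def pseudo_product_assoc top_of maximal_object_Obj Dom_in Cod_in,
    auto simp: inverse_category_of_def)

lemma is_inverse_of_iff:
  assumes "f \<in> Arr G"
  shows "is_inverse_of (inverse_category_of G) f g \<longleftrightarrow> g = ginv G f"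
proof
  assume "is_inverse_of (inverse_category_of G) f g"
  then have g: "g \<in> Arr G" "top_of G (Cod G f) = top_of G (Dom G g)"
      "top_of G (Cod G g) = top_of G (Dom G f)" "f \<otimes> g \<otimes> f = f" "g \<otimes> f \<otimes> g = g"
    using assms by (auto simp: is_inverse_of_def hom_def pseudo_product_assoc)
  have "(ginv G f, g) \<in> Le G" "(ginv G g, f) \<in> Le G"
    using g assms by (simp_all add: ginv_le_if_pseudo_regular)
  then show "g = ginv G f"
    using Le_inv [of "ginv G g" f] g(1) by (simp add: Le_antisym)
next
  assume "g = ginv G f"
  then show "is_inverse_of (inverse_category_of G) f g"
    using assms
    by (simp add: is_inverse_of_def hom_def pseudo_product_composable Dom_in Cod_in)
qed

lemma inverse_category_inverse_category_of: "inverse_category (inverse_category_of G)"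
proof -
  interpret category "inverse_category_of G"
    by (rule category_inverse_category_of)
  show ?thesis
    by unfold_locales (simp add: is_inverse_of_iff)
qed

lemma inv_arr_inverse_category_of [simp]:
  "f \<in> Arr G \<Longrightarrow> inv_arr (inverse_category_of G) f = ginv G f"
  by (simp add: inv_arr_def is_inverse_of_iff)

lemma bar_inverse_category_of [simp]:
  "f \<in> Arr G \<Longrightarrow> bar (inverse_category_of G) f = Ident G (Dom G f)"
  by (simp add: bar_def pseudo_product_composable)

lemma idempotent_inverse_category_of:
  "idempotent (inverse_category_of G) e \<longleftrightarrow> (\<exists>A \<in> Obj G. e = Ident G A)"
  unfolding inverse_category.idempotent_iff_bar [OF inverse_category_inverse_category_of]
  using Dom_in by auto metis

lemma nat_le_inverse_category_of: "nat_le (inverse_category_of G) f g \<longleftrightarrow> (f, g) \<in> Le G"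
proof
  assume "nat_le (inverse_category_of G) f g"
  then show "(f, g) \<in> Le G"
    using pseudo_product_Ident_le [of g "Dom G f"] by (auto simp: nat_le_def Dom_in)
next
  assume le: "(f, g) \<in> Le G"
  then have "f \<in> Arr G" "g \<in> Arr G"
    using Le_Arr by blast+
  then show "nat_le (inverse_category_of G) f g"
    using restriction_as_pseudo_product [OF le] top_of_eq [OF Le_Dom [OF le]]
      top_of_eq [OF Le_Cod [OF le]] by (simp add: nat_le_def Dom_in)
qed

end

section \<open>Oplax functors of inverse categories\<close>

locale oplax_map = source: inverse_category X + target: inverse_category Y
  for X :: "('o, 'a, 'm) cat_scheme" and Y :: "('p, 'b, 'n) cat_scheme" +
  fixes F :: "('o, 'a, 'p, 'b) cat_map"
  assumes oplax_functor: "oplax_functor X Y F"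
begin

lemma graph_map: "graph_map X Y F"
  using oplax_functor by (simp add: oplax_functor_def)

lemmas map_simps [simp] = graph_mapD [OF graph_map]

lemma le_comp:
  "\<lbrakk>f \<in> Arr X; g \<in> Arr X; Cod X f = Dom X g\<rbrakk>
     \<Longrightarrow> nat_le Y (AMap F (g \<cdot>\<^bsub>X\<^esub> f)) (AMap F g \<cdot>\<^bsub>Y\<^esub> AMap F f)"
  using oplax_functor by (simp add: oplax_functor_def)

lemma le_Ident: "A \<in> Obj X \<Longrightarrow> nat_le Y (AMap F (Ident X A)) (Ident Y (OMap F A))"
  using oplax_functor by (simp add: oplax_functor_def)

lemma le_comp_comp:
  assumes "f \<in> Arr X" "g \<in> Arr X" "h \<in> Arr X" "Cod X f = Dom X g" "Cod X g = Dom X h"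
  shows "nat_le Y (AMap F (h \<cdot>\<^bsub>X\<^esub> (g \<cdot>\<^bsub>X\<^esub> f))) (AMap F h \<cdot>\<^bsub>Y\<^esub> (AMap F g \<cdot>\<^bsub>Y\<^esub> AMap F f))"
proof (rule target.nat_le_trans)
  show "nat_le Y (AMap F (h \<cdot>\<^bsub>X\<^esub> (g \<cdot>\<^bsub>X\<^esub> f))) (AMap F h \<cdot>\<^bsub>Y\<^esub> AMap F (g \<cdot>\<^bsub>X\<^esub> f))"
    using assms by (intro le_comp) simp_all
  show "nat_le Y (AMap F h \<cdot>\<^bsub>Y\<^esub> AMap F (g \<cdot>\<^bsub>X\<^esub> f)) (AMap F h \<cdot>\<^bsub>Y\<^esub> (AMap F g \<cdot>\<^bsub>Y\<^esub> AMap F f))"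
    using assms by (intro target.nat_le_comp le_comp) simp_all
qed

text \<open>With \<open>x = F(e)\<close>, oplaxness for \<open>e e = e\<close> gives \<open>x \<le> x x\<close>, that is \<open>x = x x (x\<^sup>\<circ> x)\<close>, and the last factor is
absorbed by \<open>x\<close>.\<close>

lemma preserves_idempotent:
  assumes "idempotent X e"
  shows "idempotent Y (AMap F e)"
proof -
  let ?x = "AMap F e"
  have x: "?x \<in> Arr Y" "Cod Y ?x = Dom Y ?x"
    using assms by simp_all
  have "nat_le Y ?x (?x \<cdot>\<^bsub>Y\<^esub> ?x)"
    using le_comp [of e e] assms by simp
  then have "?x \<cdot>\<^bsub>Y\<^esub> ?x \<cdot>\<^bsub>Y\<^esub> bar Y ?x = ?x"
    by (rule target.nat_leD(5))
  then have "?x \<cdot>\<^bsub>Y\<^esub> ?x = ?x"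
    using x by (simp add: target.assoc)
  with x show ?thesis
    by (intro idempotentI)
qed

text \<open>Oplaxness for \<open>g g\<^sup>\<circ> g = g\<close> gives \<open>F(g) \<le> F(g) F(g\<^sup>\<circ>) F(g)\<close>. As above, the bar of \<open>F(g)\<close> that turns this
into an equation is absorbed, so \<open>F(g\<^sup>\<circ>)\<close> satisfies the equations of an inverse of \<open>F(g)\<close>.\<close>

lemma preserves_inv:
  assumes f: "f \<in> Arr X"
  shows "AMap F (inv_arr X f) = inv_arr Y (AMap F f)"
proof -
  have regular: "AMap F g \<cdot>\<^bsub>Y\<^esub> (AMap F (inv_arr X g) \<cdot>\<^bsub>Y\<^esub> AMap F g) = AMap F g" if g: "g \<in> Arr X" for g
  proof -
    have "nat_le Y (AMap F g) (AMap F g \<cdot>\<^bsub>Y\<^esub> (AMap F (inv_arr X g) \<cdot>\<^bsub>Y\<^esub> AMap F g))"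
      using le_comp_comp [of g "inv_arr X g" g] g by simp
    from target.nat_leD(5) [OF this] show ?thesis
      using g by (simp add: target.assoc)
  qed
  show ?thesis
    using regular [OF f] regular [of "inv_arr X f"] f
    by (intro target.inv_eqI [symmetric]) simp_all
qed

lemma le_comp_idempotent:
  assumes "g \<in> Arr X" "idempotent X e" "Dom X e = Dom X g"
  shows "nat_le Y (AMap F (g \<cdot>\<^bsub>X\<^esub> e)) (AMap F g)"
  using assms preserves_idempotent
  by (intro target.nat_le_trans [OF le_comp target.nat_le_comp_idempotent]) simp_all

lemma monotone: "nat_le X f g \<Longrightarrow> nat_le Y (AMap F f) (AMap F g)"
  using le_comp_idempotent [of g "bar X f"] source.nat_leD(1,2,3,5) [of f g] by simp

text \<open>One inequality is oplaxness for \<open>f\<^sup>\<circ> f\<close>. The other comes from oplaxness for \<open>f\<close> composed with its own bar: it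
shows that \<open>F(f)\<close> is defined at most where the image of the bar is.\<close>

lemma preserves_bar:
  assumes f: "f \<in> Arr X"
  shows "AMap F (bar X f) = bar Y (AMap F f)"
proof (rule target.nat_le_antisym)
  show "nat_le Y (AMap F (bar X f)) (bar Y (AMap F f))"
    using le_comp [of f "inv_arr X f"] f by (simp add: bar_def preserves_inv)
  have "nat_le Y (AMap F f) (AMap F f \<cdot>\<^bsub>Y\<^esub> AMap F (bar X f))"
    using le_comp [of "bar X f" f] f by simp
  then have "nat_le Y (bar Y (AMap F f)) (bar Y (AMap F f \<cdot>\<^bsub>Y\<^esub> AMap F (bar X f)))"
    by (rule target.nat_le_bar)
  also have "nat_le Y (bar Y (AMap F f \<cdot>\<^bsub>Y\<^esub> AMap F (bar X f))) (AMap F (bar X f))"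
    using target.bar_comp_le [of "AMap F (bar X f)" "AMap F f"] f
    by (simp add: preserves_idempotent)
  finally (target.nat_le_trans) show "nat_le Y (bar Y (AMap F f)) (AMap F (bar X f))" .
qed

text \<open>A composite kept in the groupoid has the same bar as its first factor. So \<open>F(g f)\<close>, which is below
\<open>F(g) F(f)\<close>, already has a domain of definition as large as that of \<open>F(f)\<close>.\<close>

lemma preserves_groupoid_comp:
  assumes "f \<in> Arr X" "g \<in> Arr X" "bar X (inv_arr X f) = bar X g"
  shows "AMap F (g \<cdot>\<^bsub>X\<^esub> f) = AMap F g \<cdot>\<^bsub>Y\<^esub> AMap F f"
proof (rule target.nat_le_eqI)
  note comp = source.composable_in_groupoid [OF assms]
  show "nat_le Y (AMap F (g \<cdot>\<^bsub>X\<^esub> f)) (AMap F g \<cdot>\<^bsub>Y\<^esub> AMap F f)"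
    using assms(1,2) comp(1) by (rule le_comp)
  have "nat_le Y (bar Y (AMap F g \<cdot>\<^bsub>Y\<^esub> AMap F f)) (bar Y (AMap F f))"
    using assms(1,2) comp(1) by (intro target.bar_comp_le) simp_all
  also have "bar Y (AMap F f) = bar Y (AMap F (g \<cdot>\<^bsub>X\<^esub> f))"
    using assms(1,2) comp(1,2) by (simp flip: preserves_bar)
  finally show "nat_le Y (bar Y (AMap F g \<cdot>\<^bsub>Y\<^esub> AMap F f)) (bar Y (AMap F (g \<cdot>\<^bsub>X\<^esub> f)))" .
qed

end

lemma oplax_functorI:
  assumes "graph_map X Y F"
    and "\<And>f g. \<lbrakk>f \<in> Arr X; g \<in> Arr X; Cod X f = Dom X g\<rbrakk>
       \<Longrightarrow> nat_le Y (AMap F (g \<cdot>\<^bsub>X\<^esub> f)) (AMap F g \<cdot>\<^bsub>Y\<^esub> AMap F f)"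
    and "\<And>A. A \<in> Obj X \<Longrightarrow> nat_le Y (AMap F (Ident X A)) (Ident Y (OMap F A))"
  shows "oplax_functor X Y F"
  using assms by (simp add: oplax_functor_def)

text \<open>The value of an oplax functor at an object \<open>A\<close> is the domain of its value at \<open>1\<^sub>A\<close>. Composites are oplax
because oplax functors are monotone.\<close>

lemma arrow_determined_oplax:
  "arrow_determined {X :: ('o, 'a, 'm) cat_scheme. inverse_category X} oplax_functor"
proof (rule arrow_determined.intro, unfold mem_Collect_eq)
  fix X :: "('o, 'a, 'm) cat_scheme"
  assume "inverse_category X"
  then interpret inverse_category X .
  have "category X" ..
  then show "oplax_functor X X (map_id X)"
    by (auto intro!: oplax_functorI graph_map_id)
next
  fix X Y :: "('o, 'a, 'm) cat_scheme" and F
  assume "oplax_functor X Y F"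
  then show "graph_map X Y F" by (simp add: oplax_functor_def)
next
  fix X Y Z :: "('o, 'a, 'm) cat_scheme" and F G
  assume "inverse_category X" "inverse_category Y" "inverse_category Z"
    and "oplax_functor X Y F" "oplax_functor Y Z G"
  then interpret F: oplax_map X Y F + G: oplax_map Y Z G
    by (simp_all add: oplax_map_def oplax_map_axioms_def)
  show "oplax_functor X Z (map_comp X G F)"
  proof (rule oplax_functorI)
    show "graph_map X Z (map_comp X G F)"
      using F.graph_map G.graph_map F.source.category_axioms by (rule graph_map_comp)
    fix f g assume "f \<in> Arr X" "g \<in> Arr X" "Cod X f = Dom X g"
    then show "nat_le Z (AMap (map_comp X G F) (g \<cdot>\<^bsub>X\<^esub> f))
        (AMap (map_comp X G F) g \<cdot>\<^bsub>Z\<^esub> AMap (map_comp X G F) f)"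
      using F.target.nat_leD(1) [OF F.le_comp]
      by (simp add: F.target.nat_leD G.target.nat_le_trans [OF G.monotone [OF F.le_comp] G.le_comp])
  next
    fix A assume "A \<in> Obj X"
    then show "nat_le Z (AMap (map_comp X G F) (Ident X A)) (Ident Z (OMap (map_comp X G F) A))"
      by (simp add: G.target.nat_le_trans [OF G.monotone [OF F.le_Ident] G.le_Ident])
  qed
next
  fix X Y :: "('o, 'a, 'm) cat_scheme" and F G A
  assume "inverse_category X" "inverse_category Y" "oplax_functor X Y F" "oplax_functor X Y G"
    and eq: "\<And>f. f \<in> Arr X \<Longrightarrow> AMap F f = AMap G f" and A: "A \<in> Obj X"
  then interpret F: oplax_map X Y F + G: oplax_map X Y G
    by (simp_all add: oplax_map_def oplax_map_axioms_def)
  show "OMap F A = OMap G A"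
    using F.map_simps(3) [of "Ident X A"] G.map_simps(3) [of "Ident X A"] eq [of "Ident X A"] A
    by simp
qed

section \<open>Ordered functors of top-heavy locally inductive groupoids\<close>

locale ordered_map = source: top_heavy_groupoid G + target: top_heavy_groupoid H
  for G :: "('o, 'a, 'm) ocat_scheme" and H :: "('p, 'b, 'n) ocat_scheme" +
  fixes F :: "('o, 'a, 'p, 'b) cat_map"
  assumes ordered_functor: "ordered_functor G H F"
begin

lemma graph_map: "graph_map G H F"
  using ordered_functor by (simp add: ordered_functor_def is_functor_def)

lemmas map_simps [simp] = graph_mapD [OF graph_map]

lemma map_Ident [simp]: "A \<in> Obj G \<Longrightarrow> AMap F (Ident G A) = Ident H (OMap F A)"
  using ordered_functor by (simp add: ordered_functor_def is_functor_def)

lemma map_Comp [simp]: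
  "\<lbrakk>f \<in> Arr G; g \<in> Arr G; Cod G f = Dom G g\<rbrakk> \<Longrightarrow> AMap F (g \<cdot>\<^bsub>G\<^esub> f) = AMap F g \<cdot>\<^bsub>H\<^esub> AMap F f"
  using ordered_functor by (simp add: ordered_functor_def is_functor_def)

lemma monotone: "(f, g) \<in> Le G \<Longrightarrow> (AMap F f, AMap F g) \<in> Le H"
  using ordered_functor by (auto simp: ordered_functor_def)

lemma obj_monotone: "obj_le G A B \<Longrightarrow> obj_le H (OMap F A) (OMap F B)"
  using monotone [of "Ident G A" "Ident G B"] by (simp add: obj_le_def)

lemma top_of_map_top_of: "A \<in> Obj G \<Longrightarrow> top_of H (OMap F (top_of G A)) = top_of H (OMap F A)"
  using target.top_of_eq [OF obj_monotone [OF source.top_of(2)]] by simp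

text \<open>The image of the greatest composite below \<open>g\<close> and \<open>f\<close> is a composite below the images of \<open>g\<close> and \<open>f\<close>,
though not necessarily the greatest one.\<close>

lemma map_pseudo_product_le:
  assumes "f \<in> Arr G" "g \<in> Arr G" "top_of G (Cod G f) = top_of G (Dom G g)"
  shows "(AMap F (pseudo_product G g f), pseudo_product H (AMap F g) (AMap F f)) \<in> Le H"
proof -
  obtain g' f' where k: "(g', g) \<in> Le G" "(f', f) \<in> Le G" "Cod G f' = Dom G g'"
      "pseudo_product G g f = g' \<cdot>\<^bsub>G\<^esub> f'"
    using source.pseudo_productE [OF assms] .
  then have arr: "g' \<in> Arr G" "f' \<in> Arr G"
    using source.Le_Arr by blast+
  have "top_of H (Cod H (AMap F f)) = top_of H (Dom H (AMap F g))"
    using assms top_of_map_top_of source.Cod_in source.Dom_in by (metis map_simps(3,4))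
  moreover have "AMap F (pseudo_product G g f) \<in> composites_below H (AMap F g) (AMap F f)"
    using k arr by (intro composites_belowI [OF monotone monotone]) simp_all
  ultimately show ?thesis
    using assms by (intro target.pseudo_product_greatest) simp_all
qed

end

lemma ordered_functorI:
  assumes "graph_map G H F"
    and "\<And>A. A \<in> Obj G \<Longrightarrow> AMap F (Ident G A) = Ident H (OMap F A)"
    and "\<And>f g. \<lbrakk>f \<in> Arr G; g \<in> Arr G; Cod G f = Dom G g\<rbrakk>
       \<Longrightarrow> AMap F (g \<cdot>\<^bsub>G\<^esub> f) = AMap F g \<cdot>\<^bsub>H\<^esub> AMap F f"
    and "\<And>f g. (f, g) \<in> Le G \<Longrightarrow> (AMap F f, AMap F g) \<in> Le H"
  shows "ordered_functor G H F"
  using assms by (auto simp: ordered_functor_def is_functor_def)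

lemma arrow_determined_ordered:
  "arrow_determined {G :: ('o, 'a, 'm) ocat_scheme. top_heavy_groupoid G} ordered_functor"
proof (rule arrow_determined.intro, unfold mem_Collect_eq)
  fix G :: "('o, 'a, 'm) ocat_scheme"
  assume "top_heavy_groupoid G"
  then interpret top_heavy_groupoid G .
  have "category G" ..
  then show "ordered_functor G G (map_id G)"
    using Le_Arr by (auto intro!: ordered_functorI graph_map_id)
next
  fix G H :: "('o, 'a, 'm) ocat_scheme" and F
  assume "ordered_functor G H F"
  then show "graph_map G H F" by (simp add: ordered_functor_def is_functor_def)
next
  fix G H K :: "('o, 'a, 'm) ocat_scheme" and E F
  assume "top_heavy_groupoid G" "top_heavy_groupoid H" "top_heavy_groupoid K"
    and "ordered_functor G H E" "ordered_functor H K F"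
  then interpret E: ordered_map G H E + F: ordered_map H K F
    by (simp_all add: ordered_map_def ordered_map_axioms_def)
  have "is_functor G K (map_comp G F E)"
    using E.ordered_functor F.ordered_functor E.source.category_axioms
    by (intro functor_comp [of G H]) (simp_all add: ordered_functor_def)
  then show "ordered_functor G K (map_comp G F E)"
    using E.source.Le_Arr by (auto simp: ordered_functor_def E.monotone F.monotone)
next
  fix G H :: "('o, 'a, 'm) ocat_scheme" and E F A
  assume "top_heavy_groupoid G" "top_heavy_groupoid H" "ordered_functor G H E" "ordered_functor G H F"
    and eq: "\<And>f. f \<in> Arr G \<Longrightarrow> AMap E f = AMap F f" and A: "A \<in> Obj G"
  then interpret E: ordered_map G H E + F: ordered_map G H F
    by (simp_all add: ordered_map_def ordered_map_axioms_def)
  have "Ident H (OMap E A) = Ident H (OMap F A)"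
    using eq [of "Ident G A"] A by simp
  then show "OMap E A = OMap F A"
    using E.target.Ident_inject A by simp
qed

section \<open>The two constructions on maps\<close>

text \<open>An idempotent is both an object and an arrow of the groupoid, so the object map of the ordered functor
is a restriction of the arrow map of \<open>F\<close>.\<close>

lemma (in oplax_map) ordered_functor_groupoid_of:
  "ordered_functor (groupoid_of X) (groupoid_of Y)
     \<lparr>OMap = (\<lambda>e \<in> {e. idempotent X e}. AMap F e), AMap = AMap F\<rparr>"
  (is "ordered_functor ?G ?H ?F")
proof (rule ordered_functorI)
  show "graph_map ?G ?H ?F"
    using graph_map
    by (simp add: graph_map_def hom_def preserves_idempotent preserves_bar preserves_inv)
next
  fix f g
  assume "f \<in> Arr ?G" "g \<in> Arr ?G" "Cod ?G f = Dom ?G g"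
  then have fg: "f \<in> Arr X" "g \<in> Arr X" "bar X (inv_arr X f) = bar X g"
    by simp_all
  then have "bar Y (inv_arr Y (AMap F f)) = bar Y (AMap F g)"
    by (simp flip: preserves_bar preserves_inv)
  then show "AMap ?F (g \<cdot>\<^bsub>?G\<^esub> f) = AMap ?F g \<cdot>\<^bsub>?H\<^esub> AMap ?F f"
    using fg by (simp add: preserves_groupoid_comp)
qed (simp_all add: preserves_idempotent monotone)

text \<open>An ordered functor need not preserve maximal objects, so the image of a maximal object is replaced by
the top above it. For the same reason identities are preserved only up to \<open>\<le>\<close>.\<close>

lemma (in ordered_map) oplax_functor_inverse_category_of:
  "oplax_functor (inverse_category_of G) (inverse_category_of H)
     \<lparr>OMap = (\<lambda>T \<in> {T. maximal_object G T}. top_of H (OMap F T)), AMap = AMap F\<rparr>"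
  (is "oplax_functor ?X ?Y ?F")
proof (rule oplax_functorI)
  show "graph_map ?X ?Y ?F"
    using graph_map
    by (simp add: graph_map_def hom_def target.top_of source.top_of source.maximal_object_Obj
        top_of_map_top_of source.Dom_in source.Cod_in)
next
  fix f g
  assume "f \<in> Arr ?X" "g \<in> Arr ?X" "Cod ?X f = Dom ?X g"
  then have fg: "f \<in> Arr G" "g \<in> Arr G" "top_of G (Cod G f) = top_of G (Dom G g)"
    by simp_all
  then have "top_of H (OMap F (Cod G f)) = top_of H (OMap F (Dom G g))"
    using top_of_map_top_of source.Cod_in source.Dom_in by metis
  then show "nat_le ?Y (AMap ?F (g \<cdot>\<^bsub>?X\<^esub> f)) (AMap ?F g \<cdot>\<^bsub>?Y\<^esub> AMap ?F f)"
    using fg map_pseudo_product_le [OF fg] by (simp add: target.nat_le_inverse_category_of)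
next
  fix T assume "T \<in> Obj ?X"
  then show "nat_le ?Y (AMap ?F (Ident ?X T)) (Ident ?Y (OMap ?F T))"
    using target.top_of [of "OMap F T"]
    by (simp add: target.nat_le_inverse_category_of source.maximal_object_Obj obj_le_def)
qed

section \<open>Recovering a structure from its image\<close>

definition identity_on_arrows :: "'o set \<Rightarrow> ('o \<Rightarrow> 'p) \<Rightarrow> 'a set \<Rightarrow> ('o, 'a, 'p, 'a) cat_map" where
  "identity_on_arrows Ob h Ar = \<lparr>OMap = restrict h Ob, AMap = (\<lambda>f \<in> Ar. f)\<rparr>"

lemma identity_on_arrows_simps [simp]:
  "A \<in> Ob \<Longrightarrow> OMap (identity_on_arrows Ob h Ar) A = h A"
  "f \<in> Ar \<Longrightarrow> AMap (identity_on_arrows Ob h Ar) f = f"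
  by (simp_all add: identity_on_arrows_def)

lemma graph_map_identity_on_arrowsI:
  assumes "Arr C = Arr D" "\<And>A. A \<in> Obj C \<Longrightarrow> h A \<in> Obj D"
    and "\<And>f. f \<in> Arr D \<Longrightarrow> Dom C f \<in> Obj C \<and> h (Dom C f) = Dom D f"
    and "\<And>f. f \<in> Arr D \<Longrightarrow> Cod C f \<in> Obj C \<and> h (Cod C f) = Cod D f"
  shows "graph_map C D (identity_on_arrows (Obj C) h (Arr C))"
  using assms by (simp add: graph_map_def hom_def identity_on_arrows_def)

context top_heavy_groupoid
begin

abbreviation "IG \<equiv> inverse_category_of G"

text \<open>The idempotents for the pseudo-product are the identities of \<open>G\<close>, so passing there and back only
renames each object to its identity; composites kept in the groupoid are composites of \<open>G\<close>.\<close>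

lemma to_groupoid_of_inverse_category_of:
  "ordered_functor G (groupoid_of IG) (identity_on_arrows (Obj G) (Ident G) (Arr G))"
  (is "ordered_functor _ ?H ?F")
proof (rule ordered_functorI)
  show "graph_map G ?H ?F"
    by (rule graph_map_identity_on_arrowsI)
      (auto simp: idempotent_inverse_category_of Dom_in Cod_in)
next
  fix A assume "A \<in> Obj G"
  moreover from this have "idempotent IG (Ident G A)"
    unfolding idempotent_inverse_category_of by blast
  ultimately show "AMap ?F (Ident G A) = Ident ?H (OMap ?F A)"
    by simp
qed (simp_all add: nat_le_inverse_category_of pseudo_product_composable Le_Arr)

lemma from_groupoid_of_inverse_category_of:
  "ordered_functor (groupoid_of IG) G
     (identity_on_arrows (Obj (groupoid_of IG)) (Dom G) (Arr (groupoid_of IG)))"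
  (is "ordered_functor ?H _ ?F")
proof (rule ordered_functorI)
  show "graph_map ?H G ?F"
    by (rule graph_map_identity_on_arrowsI)
      (auto simp: idempotent_inverse_category_of Dom_in Cod_in)
next
  fix f g
  assume "f \<in> Arr ?H" "g \<in> Arr ?H" "Cod ?H f = Dom ?H g"
  then have fg: "f \<in> Arr G" "g \<in> Arr G" "Ident G (Cod G f) = Ident G (Dom G g)"
    by simp_all
  then have "Cod G f = Dom G g"
    using Ident_inject Cod_in Dom_in by metis
  then show "AMap ?F (g \<cdot>\<^bsub>?H\<^esub> f) = AMap ?F g \<cdot> AMap ?F f"
    using fg by (simp add: pseudo_product_composable)
qed (auto simp: idempotent_inverse_category_of nat_le_inverse_category_of Le_Arr)

end

context inverse_category
begin

text \<open>The composite \<open>g f\<close> of \<open>X\<close> is the greatest composite in the groupoid: with \<open>m = (g\<^sup>\<circ> g)(f f\<^sup>\<circ>)\<close> it equals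
\<open>(g m)(m f)\<close>, where \<open>m\<close> is the codomain of \<open>m f\<close> and the domain of \<open>g m\<close>, and it is an upper bound
because composition in \<open>X\<close> is monotone.\<close>

lemma pseudo_product_groupoid_of:
  assumes "f \<in> Arr X" "g \<in> Arr X" "Cod X f = Dom X g"
  shows "pseudo_product (groupoid_of X) g f = g \<cdot> f"
proof (rule top_heavy_groupoid.pseudo_product_eqI [OF top_heavy_groupoid_of])
  define m where "m = bar X g \<cdot> bar X (f\<^sup>\<circ>)"
  have comm: "m = bar X (f\<^sup>\<circ>) \<cdot> bar X g"
    unfolding m_def using assms by (intro idempotent_commute) simp_all
  have m: "idempotent X m" "Dom X m = Dom X g"
    unfolding m_def using assms by (simp_all add: idempotent_comp)
  have "bar X g \<cdot> m = m" "bar X (f\<^sup>\<circ>) \<cdot> m = m"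
    using assms by (simp add: m_def idempotent_absorb, simp add: comm idempotent_absorb)
  then have bars: "bar X (g \<cdot> m) = m" "bar X (f\<^sup>\<circ> \<cdot> m) = m"
    using m assms by (simp_all add: bar_comp_idempotent)
  have "g \<cdot> m \<cdot> (m \<cdot> f) = g \<cdot> (m \<cdot> f)"
    using m assms by (simp add: assoc idempotent_absorb)
  also have "\<dots> = g \<cdot> bar X g \<cdot> (bar X (f\<^sup>\<circ>) \<cdot> f)"
    using assms by (simp add: m_def assoc del: bar_simps(5,6))
  also have "\<dots> = g \<cdot> f"
    using assms by simp
  finally have eq: "g \<cdot> m \<cdot> (m \<cdot> f) = g \<cdot> f" .
  show "g \<cdot> f \<in> composites_below (groupoid_of X) g f"
  proof (rule composites_belowI)
    show "(g \<cdot> m, g) \<in> Le (groupoid_of X)" "(m \<cdot> f, f) \<in> Le (groupoid_of X)"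
      using m assms by (simp_all add: nat_le_comp_idempotent nat_le_idempotent_comp)
    show "Cod (groupoid_of X) (m \<cdot> f) = Dom (groupoid_of X) (g \<cdot> m)"
      using m assms bars by simp
    then show "g \<cdot> f = Comp (groupoid_of X) (g \<cdot> m) (m \<cdot> f)"
      using m assms eq by simp
  qed
  fix k assume "k \<in> composites_below (groupoid_of X) g f"
  then obtain g' f' where k: "g' \<sqsubseteq> g" "f' \<sqsubseteq> f" "Cod (groupoid_of X) f' = Dom (groupoid_of X) g'"
      "k = Comp (groupoid_of X) g' f'"
    by (auto simp: composites_below_def)
  then have "g' \<in> Arr X" "f' \<in> Arr X"
    using nat_leD(1) by blast+
  then show "(k, g \<cdot> f) \<in> Le (groupoid_of X)"
    using k composable_in_groupoid(1) [of f' g'] by (simp add: nat_le_comp)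
qed

abbreviation "GX \<equiv> groupoid_of X"

lemma Dom_Cod_inverse_category_of_groupoid_of:
  assumes "f \<in> Arr X"
  shows "Dom (inverse_category_of GX) f = Ident X (Dom X f)"
    "Cod (inverse_category_of GX) f = Ident X (Cod X f)"
  using assms by (simp_all add: top_of_groupoid_of)

lemma Comp_inverse_category_of_groupoid_of:
  assumes "f \<in> Arr X" "g \<in> Arr X" "Cod X f = Dom X g"
  shows "g \<cdot>\<^bsub>inverse_category_of GX\<^esub> f = g \<cdot> f"
  using assms by (simp add: top_of_groupoid_of pseudo_product_groupoid_of)

lemma nat_le_inverse_category_of_groupoid_of:
  "nat_le (inverse_category_of GX) f g \<longleftrightarrow> f \<sqsubseteq> g"
  by (simp add: top_heavy_groupoid.nat_le_inverse_category_of [OF top_heavy_groupoid_of])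

text \<open>The objects of the source are the maximal idempotents, that is, the identities of \<open>X\<close>, and its
composition is that of \<open>X\<close>; this comparison map is even a functor.\<close>

lemma from_inverse_category_of_groupoid_of:
  "oplax_functor (inverse_category_of GX) X
     (identity_on_arrows (Obj (inverse_category_of GX)) (Dom X) (Arr (inverse_category_of GX)))"
  (is "oplax_functor ?Y _ ?F")
proof (rule oplax_functorI)
  show "graph_map ?Y X ?F"
    by (rule graph_map_identity_on_arrowsI)
      (auto simp: maximal_object_groupoid_of top_of_groupoid_of Dom_in Cod_in)
next
  fix f g
  assume "f \<in> Arr ?Y" "g \<in> Arr ?Y" "Cod ?Y f = Dom ?Y g"
  then have fg: "f \<in> Arr X" "g \<in> Arr X" "Cod X f = Dom X g"
    using Ident_inject Cod_in Dom_in by (auto simp: Dom_Cod_inverse_category_of_groupoid_of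
        simp del: inverse_category_of_simps(3,4))
  then show "nat_le X (AMap ?F (g \<cdot>\<^bsub>?Y\<^esub> f)) (AMap ?F g \<cdot> AMap ?F f)"
    by (simp add: Comp_inverse_category_of_groupoid_of del: inverse_category_of_simps(6))
qed (auto simp: maximal_object_groupoid_of idempotent_Ident)

lemma to_inverse_category_of_groupoid_of:
  "oplax_functor X (inverse_category_of GX) (identity_on_arrows (Obj X) (Ident X) (Arr X))"
  (is "oplax_functor _ ?Y ?F")
proof (rule oplax_functorI)
  show "graph_map X ?Y ?F"
    by (rule graph_map_identity_on_arrowsI)
      (auto simp: maximal_object_groupoid_of top_of_groupoid_of Dom_in Cod_in)
next
  fix A assume "A \<in> Obj X"
  moreover from this have "maximal_object GX (Ident X A)"
    unfolding maximal_object_groupoid_of by blast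
  ultimately show "nat_le ?Y (AMap ?F (Ident X A)) (Ident ?Y (OMap ?F A))"
    by (simp add: nat_le_inverse_category_of_groupoid_of idempotent_Ident)
qed (simp add: nat_le_inverse_category_of_groupoid_of Comp_inverse_category_of_groupoid_of
    del: inverse_category_of_simps(6))

end

section \<open>The equivalence\<close>

lemma construction_inverse_category_of:
  "arrow_preserving_construction {G :: ('u, 'u) ocat. top_heavy_groupoid G} ordered_functor
     {X. inverse_category X} oplax_functor inverse_category_of"
proof (intro arrow_preserving_construction.intro arrow_preserving_construction_axioms.intro
    arrow_determined_ordered arrow_determined_oplax, unfold mem_Collect_eq)
  fix G :: "('u, 'u) ocat"
  assume "top_heavy_groupoid G"
  then show "inverse_category (inverse_category_of G)"
    by (rule top_heavy_groupoid.inverse_category_inverse_category_of)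
  show "Arr (inverse_category_of G) = Arr G" by simp
next
  fix G H :: "('u, 'u) ocat" and F
  assume "top_heavy_groupoid G" "top_heavy_groupoid H" "ordered_functor G H F"
  then interpret ordered_map G H F
    by (simp add: ordered_map_def ordered_map_axioms_def)
  show "\<exists>F'. oplax_functor (inverse_category_of G) (inverse_category_of H) F'
      \<and> (\<forall>f \<in> Arr G. AMap F' f = AMap F f)"
    using oplax_functor_inverse_category_of by force
qed

lemma construction_groupoid_of:
  "arrow_preserving_construction {X :: ('u, 'u) cat. inverse_category X} oplax_functor
     {G. top_heavy_groupoid G} ordered_functor groupoid_of"
proof (intro arrow_preserving_construction.intro arrow_preserving_construction_axioms.intro
    arrow_determined_ordered arrow_determined_oplax, unfold mem_Collect_eq)
  fix X :: "('u, 'u) cat"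
  assume "inverse_category X"
  then show "top_heavy_groupoid (groupoid_of X)"
    by (rule inverse_category.top_heavy_groupoid_of)
  show "Arr (groupoid_of X) = Arr X" by simp
next
  fix X Y :: "('u, 'u) cat" and F
  assume "inverse_category X" "inverse_category Y" "oplax_functor X Y F"
  then interpret oplax_map X Y F
    by (simp add: oplax_map_def oplax_map_axioms_def)
  show "\<exists>F'. ordered_functor (groupoid_of X) (groupoid_of Y) F'
      \<and> (\<forall>f \<in> Arr X. AMap F' f = AMap F f)"
    using ordered_functor_groupoid_of by force
qed

theorem theorem2p20:
  shows "equivalent_categories
           (Top_Heavy_Groupoids :: 'u th_groupoids) (Inverse_Categories :: 'u inv_cats)"
  unfolding Top_Heavy_Groupoids_def Inverse_Categories_def top_heavy_groupoid_iff [symmetric]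
  by (rule equivalence_by_arrow_preserving_constructions
      [OF construction_inverse_category_of construction_groupoid_of, where
        E = "\<lambda>G. identity_on_arrows (Obj G) (Ident G) (Arr G)" and
        E' = "\<lambda>G. let GIG = groupoid_of (inverse_category_of G) in
          identity_on_arrows (Obj GIG) (Dom G) (Arr GIG)" and
        D = "\<lambda>X. let IGX = inverse_category_of (groupoid_of X) in
          identity_on_arrows (Obj IGX) (Dom X) (Arr IGX)" and
        D' = "\<lambda>X. identity_on_arrows (Obj X) (Ident X) (Arr X)"])
    (simp_all add: Let_def
      top_heavy_groupoid.to_groupoid_of_inverse_category_of
      top_heavy_groupoid.from_groupoid_of_inverse_category_of [simplified]
      inverse_category.from_inverse_category_of_groupoid_of [simplified]
      inverse_category.to_inverse_category_of_groupoid_of)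

end
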